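(* Let $s$ and $d$ be relatively prime positive integers and let $p\ge 2$ be an integer. Then the mapping $\phi_{(s+d,d)}$ (defined in the context) restricts to a one-to-one correspondence between the set $\mathcal{SC}_{(s,s+d,\dots,s+pd)}$ of self-conjugate $(s,s+d,\dots,s+pd)$-core partitions and the set of paths $P\in\mathcal{F}(\lfloor s/2\rfloor+\lceil d/2\rceil,\,-\lceil d/2\rceil)$ satisfying all of the following: (i) if $p\ge 3$, $P$ has no $UF^iU$ as a consecutive subpath for all $i=0,1,\dots,p-3$; (ii) $P$ does not start with $F^jU$, and (iii) $P$ does not end with $UF^k$, for all $j,k$ in the following ranges: (a) when $s$ is odd and $d$ is even: $j=0,1,\dots,\lfloor (p-4)/2\rfloor$ if $p\ge4$ (no condition on the start of $P$ if $p<4$), and $k=0,1,\dots,\lfloor (p-3)/2\rfloor$ if $p\ge 3$ (no condition on the end of $P$ if $p<3$); (b) when $s$ is odd and $d$ is odd: $j=0,1,\dots,\lfloor (p-4)/2\rfloor$ if $p\ge 4$ (no condition on the start of $P$ if $p<4$), and $k=0,1,\dots,p-2$; (c) when $s$ is even and $d$ is odd: $j=0,1,\dots,\lfloor (p-3)/2\rfloor$ if $p\ge 3$ (no condition on the start of $P$ if $p<3$), and $k=0,1,\dots,p-2$.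
   Context: A partition is a finite (possibly empty) non-increasing sequence of positive integers, identified with its Young diagram. The hook length of a box is the number of boxes to its right in the same row plus the number of boxes below it in the same column plus $1$. A partition is an $s$-core if no box has hook length $s$, and an $(s_1,\dots,s_q)$-core if it is an $s_i$-core for every $i$. A partition is self-conjugate if its Young diagram is invariant under reflection in the main diagonal. $\mathcal{SC}_{(s_1,\dots,s_q)}$ denotes the set of self-conjugate $(s_1,\dots,s_q)$-core partitions. $MD(\lambda)$ denotes the set of hook lengths of the main diagonal boxes of $\lambda$; for self-conjugate $\lambda$ these are distinct odd numbers. Free rational Motzkin paths: $\mathcal{F}(m,t)$ is the set of all lattice paths from $(0,0)$ to $(m,t)$ consisting of steps $U=(1,1)$, $D=(1,-1)$, $F=(1,0)$. A path is written as the word of its steps; $F^i$ is $i$ consecutive $F$ steps ($F^0$ is empty). Abacus: for relatively prime positive integers $s,d$, let $a=a(s,d)$ be the integer such that $-a$ is the smallest odd number among $s$ and $s+d$ (so $a=-s$ if $s$ is odd and $a=-(s+d)$ if $s$ is even). The $(s+d,d;a)$-abacus diagram has rows indexed by $i\in\mathbb{Z}$ and columns indexed by $j\in\{0,1,\dots,\lfloor (s+d-1)/2\rfloor\}$; position $(i,j)$ has label $a+2(s+d)i+2dj$ (all labels are odd). The $(s+d,d;a)$-abacus of a self-conjugate partition $\lambda$ is obtained by placing a bead on each position with label $\ell$ such that $|\ell|\in MD(\lambda)$; positions without a bead are spacers. Abacus function: for $p\ge2$ and $\lambda\in\mathcal{SC}_{(s,s+d,\dots,s+pd)}$, the $(s+d,d;a)$-abacus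 function $f:\{0,1,\dots,\lfloor (s+d-1)/2\rfloor\}\to\mathbb{Z}$ of $\lambda$ is defined as follows. If some position in column $j$ with a positive label carries a bead, then $f(j)$ is the largest $i$ such that position $(i,j)$ carries a bead; otherwise $f(j)$ is the largest $i$ such that position $(i,j)$ is a spacer with a negative label. The map $\phi_{(s+d,d)}:\mathcal{SC}_{(s,s+d,s+2d)}\to\mathcal{F}(\lfloor s/2\rfloor+\lceil d/2\rceil,-\lceil d/2\rceil)$: given $\lambda$ with abacus function $f$, when $d$ is odd additionally set $f(\lfloor s/2\rfloor+(d+1)/2)=-(d+1)/2$. Then $\phi_{(s+d,d)}(\lambda)$ is the path starting at $(0,0)$ whose $j$th step is $(1,f(j)-f(j-1))$ for $j=1,\dots,\lfloor s/2\rfloor+\lceil d/2\rceil$. *)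

theory Defs
  imports Main "HOL-Library.Sublist" "HOL-Library.Product_Plus"
begin

section \<open>Partitions, hooks and cores\<close>

definition is_partition :: "nat list \<Rightarrow> bool" where
  "is_partition xs \<longleftrightarrow> sorted_wrt (\<ge>) xs \<and> (\<forall>x\<in>set xs. 0 < x)"

text \<open>Boxes are pairs (row, column), both counted from 0, in English notation.\<close>

definition young :: "nat list \<Rightarrow> (nat \<times> nat) set" where
  "young xs = {(i, j). i < length xs \<and> j < xs ! i}"

definition hook_length :: "nat list \<Rightarrow> nat \<times> nat \<Rightarrow> nat" where
  "hook_length xs = (\<lambda>(i, j).
     card {j'. j < j' \<and> (i, j') \<in> young xs} + card {i'. i < i' \<and> (i', j) \<in> young xs} + 1)"

definition is_core :: "nat \<Rightarrow> nat list \<Rightarrow> bool" where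
  "is_core s xs \<longleftrightarrow> (\<forall>b\<in>young xs. hook_length xs b \<noteq> s)"

definition self_conjugate :: "nat list \<Rightarrow> bool" where
  "self_conjugate xs \<longleftrightarrow> prod.swap ` young xs = young xs"

definition SC :: "nat list \<Rightarrow> nat list set" where
  "SC ss = {xs. is_partition xs \<and> self_conjugate xs \<and> (\<forall>s\<in>set ss. is_core s xs)}"

definition MD :: "nat list \<Rightarrow> nat set" where
  "MD xs = {hook_length xs (i, i) |i. (i, i) \<in> young xs}"


section \<open>Free rational Motzkin paths\<close>

text \<open>A path starting at the origin is the list of its steps, each step being a vector.\<close>

type_synonym step = "int \<times> int"

abbreviation U :: step where "U \<equiv> (1, 1)"
abbreviation D :: step where "D \<equiv> (1, -1)"
abbreviation F :: step where "F \<equiv> (1, 0)"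

definition free_motzkin :: "int \<Rightarrow> int \<Rightarrow> step list set" where
  "free_motzkin m t = {P. set P \<subseteq> {U, D, F} \<and> sum_list P = (m, t)}"


section \<open>The abacus and the map to paths\<close>

definition abacus_a :: "nat \<Rightarrow> nat \<Rightarrow> int" where
  "abacus_a s d = (if odd s then - int s else - int (s + d))"

definition abacus_label :: "nat \<Rightarrow> nat \<Rightarrow> int \<Rightarrow> nat \<Rightarrow> int" where
  "abacus_label s d i j = abacus_a s d + 2 * int (s + d) * i + 2 * int d * int j"

definition bead :: "nat \<Rightarrow> nat \<Rightarrow> nat list \<Rightarrow> int \<Rightarrow> nat \<Rightarrow> bool" where
  "bead s d xs i j \<longleftrightarrow> \<bar>abacus_label s d i j\<bar> \<in> int ` MD xs"

text \<open>
  Only the columns \<open>j \<le> (s + d - 1) div 2\<close> belong to the abacus; for other \<open>j\<close> the value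
  below has no meaning and is never used. The \<open>GREATEST\<close> operator is well-defined here because
  a partition has finitely many beads and labels increase strictly along each column.
\<close>

definition abacus_fun :: "nat \<Rightarrow> nat \<Rightarrow> nat list \<Rightarrow> nat \<Rightarrow> int" where
  "abacus_fun s d xs j =
     (if \<exists>i. 0 < abacus_label s d i j \<and> bead s d xs i j
      then GREATEST i. bead s d xs i j
      else GREATEST i. abacus_label s d i j < 0 \<and> \<not> bead s d xs i j)"

text \<open>
  For naturals, \<open>(d + 1) div 2\<close> is the ceiling of \<open>d / 2\<close>. For odd \<open>d\<close> the point at which
  the abacus function is extended is the first one to the right of the last column.
\<close>

definition abacus_fun_ext :: "nat \<Rightarrow> nat \<Rightarrow> nat list \<Rightarrow> nat \<Rightarrow> int" where
  "abacus_fun_ext s d xs =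
     (if odd d
      then (abacus_fun s d xs)(s div 2 + (d + 1) div 2 := - int ((d + 1) div 2))
      else abacus_fun s d xs)"

definition \<phi> :: "nat \<Rightarrow> nat \<Rightarrow> nat list \<Rightarrow> step list" where
  "\<phi> s d xs =
     map (\<lambda>j. (1, abacus_fun_ext s d xs j - abacus_fun_ext s d xs (j - 1)))
       [1..<s div 2 + (d + 1) div 2 + 1]"

end

(* For self-conjugate lam with parts lam_i, the set X of all 2 (lam_i - i) - 1 (i = 0, 1, ...)
   consists of odd integers, contains exactly one of z and -z for every odd z, and has MD lam as its
   positive part; lam is a t-core iff X is closed under subtracting 2 t. If g j is the largest row
   with a label of X in column j, now for every integer j, then X is described by g, and lam is an
   (s, s+d, ..., s+pd)-core iff g has steps in {-1, 0, 1} and never rises by more than 1 over a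
   distance below p. Moreover g (j + s + d) = g j - d, and the symmetry of X makes g odd about -1/2
   (s odd) or 0 (s even). So g is determined by its values up to the next centre of symmetry, which
   form the path. A rise by 2 at minimal distance is a subpath U F^i U; if it contains a centre it is
   symmetric about it, or, when the last step of the path stands for a step across a half-integral
   centre, it starts or ends there. This gives the conditions on the two ends of the path. *)
theory Submission
  imports Defs
begin

section \<open>Self-conjugate partitions as symmetric sets of odd integers\<close>

definition row :: "nat list \<Rightarrow> nat \<Rightarrow> nat" where
  "row xs i = (if i < length xs then xs ! i else 0)"

text \<open>The Maya diagram (beta-set) of the partition, scaled to odd integers so that its
  symmetry is about 0.\<close>

definition maya :: "nat list \<Rightarrow> int set" where
  "maya xs = range (\<lambda>i. 2 * int (row xs i) - 2 * int i - 1)"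

lemma mem_young: "(i, j) \<in> young xs \<longleftrightarrow> j < row xs i"
  by (auto simp: young_def row_def)

lemma row_antimono: "is_partition xs \<Longrightarrow> i \<le> j \<Longrightarrow> row xs j \<le> row xs i"
  by (cases "i = j") (auto simp: is_partition_def row_def sorted_wrt_iff_nth_less)

lemma row_sym: "self_conjugate xs \<Longrightarrow> j < row xs i \<longleftrightarrow> i < row xs j"
proof -
  assume "self_conjugate xs"
  then have eq: "prod.swap ` young xs = young xs" by (simp add: self_conjugate_def)
  have "(j, i) \<in> young xs" if "(i, j) \<in> young xs" for i j
    using imageI[OF that, of prod.swap] eq by simp
  then show ?thesis by (auto simp flip: mem_young)
qed

text \<open>By symmetry column \<open>j\<close> has length \<open>row xs j\<close>. The hook length
  is thus half the sum of the elements of \<open>maya xs\<close> given by rows \<open>i\<close> and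
  \<open>j\<close>.\<close>

lemma hook_length_self_conjugate:
  assumes "self_conjugate xs" "j < row xs i"
  shows "int (hook_length xs (i, j)) = int (row xs i) - int i + int (row xs j) - int j - 1"
proof -
  have "{j'. j < j' \<and> (i, j') \<in> young xs} = {j<..<row xs i}"
    by (auto simp: mem_young)
  moreover have "{i'. i < i' \<and> (i', j) \<in> young xs} = {i<..<row xs j}"
    using row_sym[OF assms(1)] by (auto simp: mem_young)
  moreover have "i < row xs j"
    using row_sym[OF assms(1)] assms(2) by blast
  ultimately show ?thesis
    using assms(2) by (simp add: hook_length_def)
qed

lemma maya_odd: "z \<in> maya xs \<Longrightarrow> odd z"
  by (auto simp: maya_def)

text \<open>Elements mark the vertical edges of the boundary, the other odd numbers the horizontal
  ones; reflection in the diagonal negates positions and exchanges the two kinds.\<close>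

lemma maya_uminus:
  assumes "is_partition xs" "self_conjugate xs" "odd z"
  shows "- z \<in> maya xs \<longleftrightarrow> z \<notin> maya xs"
proof
  assume "- z \<in> maya xs"
  then obtain i where i: "- z = 2 * int (row xs i) - 2 * int i - 1" by (auto simp: maya_def)
  show "z \<notin> maya xs"
  proof
    assume "z \<in> maya xs"
    then obtain j where j: "z = 2 * int (row xs j) - 2 * int j - 1" by (auto simp: maya_def)
    \<comment> \<open>The two rows would have total length \<open>i + j + 1\<close>; by symmetry it
      is at most \<open>i + j\<close> or at least \<open>i + j + 2\<close>.\<close>
    show False using i j row_sym[OF assms(2), of i j] by linarith
  qed
next
  assume nz: "z \<notin> maya xs"
  from assms(3) obtain k where "z = 2 * k + 1" by (elim oddE)
  then obtain k where k: "z = 2 * k - 1" using that[of "k + 1"] by simp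
  let ?P = "\<lambda>i. int (row xs i) - int i \<le> k"
  have "?P (row xs 0 + nat \<bar>k\<bar>)"
    using row_antimono[OF assms(1) le0, of "row xs 0 + nat \<bar>k\<bar>"] by simp
  define i where "i = (LEAST i. ?P i)"
  have Pi: "?P i" unfolding i_def by (rule LeastI) fact
  have least: "\<not> ?P i'" if "i' < i" for i' using not_less_Least that unfolding i_def by blast
  have "int (row xs i) - int i \<noteq> k"
  proof
    assume "int (row xs i) - int i = k"
    then have "z = 2 * int (row xs i) - 2 * int i - 1" using k by simp
    then show False using nz unfolding maya_def by blast
  qed
  with Pi have lt: "int (row xs i) - int i < k" by linarith
  \<comment> \<open>Row \<open>i\<close> misses column \<open>j\<close> and row
    \<open>i - 1\<close>, if there is one, meets it. So column \<open>j\<close>, and by symmetry row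
    \<open>j\<close>, has length \<open>i\<close>.\<close>
  define j where "j = nat (int i + k - 1)"
  have j: "int j = int i + k - 1" using lt unfolding j_def by linarith
  have "\<not> j < row xs i" using lt j by linarith
  then have "row xs j \<le> i" using row_sym[OF assms(2), of j i] by linarith
  moreover have "i \<le> row xs j"
  proof (cases i)
    case (Suc i')
    have "j < row xs i'" using least[of i'] j Suc by linarith
    then show ?thesis using row_sym[OF assms(2), of j i'] Suc by linarith
  qed simp
  ultimately have "- z = 2 * int (row xs j) - 2 * int j - 1" using j k by linarith
  then show "- z \<in> maya xs" unfolding maya_def by blast
qed

text \<open>By \<open>maya_uminus\<close>, an element \<open>z\<close> with \<open>z - 2 * t\<close>
  missing amounts to two elements with sum \<open>2 * t\<close>, that is, to a box with hook length
  \<open>t\<close>.\<close>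

lemma is_core_iff_maya:
  assumes "is_partition xs" "self_conjugate xs" "0 < t"
  shows "is_core t xs \<longleftrightarrow> (\<forall>z\<in>maya xs. z - 2 * int t \<in> maya xs)"
proof
  assume core: "is_core t xs"
  show "\<forall>z\<in>maya xs. z - 2 * int t \<in> maya xs"
  proof (rule ballI, rule ccontr)
    fix z assume z: "z \<in> maya xs" and nz: "z - 2 * int t \<notin> maya xs"
    then have "- (z - 2 * int t) \<in> maya xs"
      using maya_uminus[OF assms(1,2), of "z - 2 * int t"] maya_odd[OF z] by simp
    then obtain j where j: "- (z - 2 * int t) = 2 * int (row xs j) - 2 * int j - 1"
      by (auto simp: maya_def)
    obtain i where i: "z = 2 * int (row xs i) - 2 * int i - 1"
      using z by (auto simp: maya_def)
    have box: "j < row xs i" using i j assms(3) row_sym[OF assms(2), of i j] by linarith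
    have "hook_length xs (i, j) = t"
      using hook_length_self_conjugate[OF assms(2) box] i j by linarith
    then show False using core box by (auto simp: is_core_def mem_young)
  qed
next
  assume closed: "\<forall>z\<in>maya xs. z - 2 * int t \<in> maya xs"
  show "is_core t xs" unfolding is_core_def
  proof (rule ballI, rule notI)
    fix x assume x: "x \<in> young xs" and hook: "hook_length xs x = t"
    obtain i j where ij: "x = (i, j)" by fastforce
    have "j < row xs i" using x ij by (simp add: mem_young)
    from hook_length_self_conjugate[OF assms(2) this] hook ij
    have t: "int t = int (row xs i) - int i + int (row xs j) - int j - 1" by simp
    let ?z = "2 * int (row xs i) - 2 * int i - 1" and ?w = "2 * int (row xs j) - 2 * int j - 1"
    have "?z \<in> maya xs" "?w \<in> maya xs" by (auto simp: maya_def)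
    moreover have "?z - 2 * int t = - ?w" using t by simp
    ultimately have "- ?w \<in> maya xs" using closed by metis
    then show False
      using maya_uminus[OF assms(1,2), of ?w] \<open>?w \<in> maya xs\<close> by simp
  qed
qed

lemma MD_eq_maya:
  assumes "self_conjugate xs"
  shows "int ` MD xs = {z \<in> maya xs. 0 < z}"
proof (intro equalityI subsetI)
  fix z assume "z \<in> int ` MD xs"
  then obtain i where i: "z = int (hook_length xs (i, i))" "i < row xs i"
    by (auto simp: MD_def mem_young)
  then have "z = 2 * int (row xs i) - 2 * int i - 1"
    using hook_length_self_conjugate[OF assms, of i i] by simp
  then have "z \<in> maya xs" unfolding maya_def by blast
  moreover have "0 < z" using i(1) by (simp add: hook_length_def)
  ultimately show "z \<in> {z \<in> maya xs. 0 < z}" by blast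
next
  fix z assume "z \<in> {z \<in> maya xs. 0 < z}"
  then obtain i where i: "z = 2 * int (row xs i) - 2 * int i - 1" "0 < z"
    by (auto simp: maya_def)
  then have "i < row xs i" by linarith
  then have "z = int (hook_length xs (i, i))" "hook_length xs (i, i) \<in> MD xs"
    using hook_length_self_conjugate[OF assms, of i i] i by (auto simp: MD_def mem_young)
  then show "z \<in> int ` MD xs" by blast
qed

section \<open>Recovering a self-conjugate partition from its set of odd integers\<close>

lemma strict_antimono_range_eqD:
  fixes u v :: "nat \<Rightarrow> int"
  assumes "\<And>i j. i < j \<Longrightarrow> u j < u i" "\<And>i j. i < j \<Longrightarrow> v j < v i" "range u = range v"
  shows "u n = v n"
proof (induction n rule: less_induct)
  case (less n)
  have le: "u n \<le> v n" if u: "\<And>i j. i < j \<Longrightarrow> u j < u i" and v: "\<And>i j. i < j \<Longrightarrow> v j < v i"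
    and "range u = range v" and IH: "\<And>i. i < n \<Longrightarrow> u i = v i" for u v :: "nat \<Rightarrow> int"
  proof -
    obtain k where k: "u n = v k" using \<open>range u = range v\<close> by (metis rangeE rangeI)
    have "\<not> k < n" using u[of k n] IH[of k] k by auto
    then show ?thesis using v[of n k] k by (cases "k = n") auto
  qed
  show ?case
    using le[of u v] le[of v u] assms less by fastforce
qed

lemma partition_eq_if_row_eq:
  assumes "is_partition xs" "is_partition ys" "\<And>i. row xs i = row ys i"
  shows "xs = ys"
proof -
  have len: "i < length zs \<longleftrightarrow> 0 < row zs i" if "is_partition zs" for i zs
    using that by (auto simp: is_partition_def row_def)
  have l: "length xs = length ys"
    using len[OF assms(1)] len[OF assms(2)] assms(3)
    by (metis linorder_neq_iff order_less_irrefl)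
  then show ?thesis
    by (rule nth_equalityI) (use l assms(3) in \<open>simp add: row_def, metis\<close>)
qed

lemma maya_inject:
  assumes "is_partition xs" "is_partition ys" "maya xs = maya ys"
  shows "xs = ys"
proof (rule partition_eq_if_row_eq[OF assms(1,2)])
  fix i
  let ?u = "\<lambda>xs i. 2 * int (row xs i) - 2 * int i - 1"
  have "?u zs j < ?u zs i" if "is_partition zs" "i < j" for zs i j
    using row_antimono[OF that(1), of i j] that(2) by simp
  then have "?u xs i = ?u ys i"
    using assms by (intro strict_antimono_range_eqD) (auto simp: maya_def)
  then show "row xs i = row ys i" by simp
qed

lemma maya_le: "is_partition xs \<Longrightarrow> z \<in> maya xs \<Longrightarrow> z \<le> 2 * int (row xs 0)"
proof -
  assume "is_partition xs" "z \<in> maya xs"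
  then obtain i where "z = 2 * int (row xs i) - 2 * int i - 1" by (auto simp: maya_def)
  then show ?thesis using row_antimono[OF \<open>is_partition xs\<close>, of 0 i] by simp
qed

text \<open>Adding a new largest diagonal hook \<open>m\<close> adjoins a first row and a first column.\<close>
lemma exists_self_conjugate_maya:
  assumes "finite S" "\<And>z. z \<in> S \<Longrightarrow> 0 < z \<and> odd z"
  shows "\<exists>xs. is_partition xs \<and> self_conjugate xs \<and> {z \<in> maya xs. 0 < z} = S"
  using assms
proof (induction S rule: finite_linorder_max_induct)
  case empty
  have "is_partition []" "self_conjugate []" "{z \<in> maya []. 0 < z} = {}"
    by (auto simp: is_partition_def self_conjugate_def young_def maya_def row_def)
  then show ?case by blast
next
  case (insert m S)
  then obtain xs where xs: "is_partition xs" "self_conjugate xs" "{z \<in> maya xs. 0 < z} = S"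
    by auto
  have "0 < m \<and> odd m" using insert.prems by blast
  then obtain k where k: "m = 2 * int k + 1"
    by (metis oddE zero_less_imp_eq_int even_of_nat of_nat_add of_nat_mult of_nat_numeral of_nat_1)
  \<comment> \<open>Row \<open>i\<close> becomes row \<open>i + 1\<close> and gains a box, which
    keeps its element. The rows of \<open>xs\<close> from \<open>k\<close> on are empty and give
    negative elements only, so positive ones change just by \<open>m\<close>.\<close>
  define ys where "ys = Suc k # map Suc (map (row xs) [0..<k])"
  have row0: "row ys 0 = Suc k"
    and rowS: "row ys (Suc i) = (if i < k then Suc (row xs i) else 0)" for i
    by (auto simp: row_def ys_def)
  have r0: "row xs 0 \<le> k"
  proof (cases "row xs 0")
    case (Suc r)
    have "2 * int (row xs 0) - 2 * int 0 - 1 \<in> maya xs" unfolding maya_def by blast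
    then have "2 * int (row xs 0) - 2 * int 0 - 1 \<in> {z \<in> maya xs. 0 < z}"
      using Suc by simp
    then show ?thesis using insert.hyps(2) xs(3) k by fastforce
  qed simp
  have rk: "row xs i \<le> k" for i using row_antimono[OF xs(1), of 0 i] r0 by simp
  have rz: "row xs i = 0" if "k \<le> i" for i
    using row_sym[OF xs(2), of 0 i] r0 that by linarith
  have part: "is_partition ys"
    using rk row_antimono[OF xs(1)]
    by (auto simp: is_partition_def ys_def sorted_wrt_map intro!: sorted_wrt_mono_rel[OF _ sorted_wrt_upt])
  have "j < row ys i \<longleftrightarrow> i < row ys j" for i j
    using row_sym[OF xs(2)] row0 rowS rk rz
    by (cases i; cases j) (auto simp: order.strict_trans2)
  then have "(i, j) \<in> young ys \<longleftrightarrow> (j, i) \<in> young ys" for i j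
    by (simp add: mem_young)
  then have sc: "self_conjugate ys"
    by (force simp: self_conjugate_def image_iff)
  have "z \<in> maya ys \<and> 0 < z \<longleftrightarrow> z = m \<or> z \<in> maya xs \<and> 0 < z" for z
  proof
    assume "z \<in> maya ys \<and> 0 < z"
    then obtain i where i: "z = 2 * int (row ys i) - 2 * int i - 1" "0 < z" by (auto simp: maya_def)
    show "z = m \<or> z \<in> maya xs \<and> 0 < z"
    proof (cases i)
      case (Suc i')
      then have "z = 2 * int (row xs i') - 2 * int i' - 1"
        using i rowS[of i'] by (auto split: if_splits)
      then show ?thesis using i by (auto simp: maya_def)
    qed (use i row0 k in simp)
  next
    assume "z = m \<or> z \<in> maya xs \<and> 0 < z"
    then show "z \<in> maya ys \<and> 0 < z"
    proof (elim disjE conjE)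
      assume "z = m"
      then have "z = 2 * int (row ys 0) - 2 * int 0 - 1" using row0 k by simp
      then have "z \<in> maya ys" unfolding maya_def by blast
      then show ?thesis using \<open>z = m\<close> k by simp
    next
      assume "z \<in> maya xs" "0 < z"
      then obtain i where i: "z = 2 * int (row xs i) - 2 * int i - 1" by (auto simp: maya_def)
      then have "i < k" using \<open>0 < z\<close> rz[of i] by linarith
      then have "z = 2 * int (row ys (Suc i)) - 2 * int (Suc i) - 1" using rowS[of i] i by simp
      then show ?thesis using \<open>0 < z\<close> unfolding maya_def by blast
    qed
  qed
  then have "{z \<in> maya ys. 0 < z} = insert m S" using xs(3) by auto
  then show ?case using part sc by blast
qed

section \<open>Paths and their height functions\<close>

text \<open>Only differences of \<open>h\<close> enter, so the normalisation \<open>h 0 = 0\<close>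
  is imposed separately.\<close>

definition path :: "(nat \<Rightarrow> int) \<Rightarrow> nat \<Rightarrow> step list" where
  "path h n = map (\<lambda>j. (1, h (Suc j) - h j)) [0..<n]"

lemma length_path [simp]: "length (path h n) = n"
  by (simp add: path_def)

lemma nth_path [simp]: "j < n \<Longrightarrow> path h n ! j = (1, h (Suc j) - h j)"
  by (simp add: path_def)

lemma sum_list_path: "sum_list (path h n) = (int n, h n - h 0)"
  by (induction n) (auto simp: path_def zero_prod_def)

lemma path_cong: "(\<And>j. j \<le> n \<Longrightarrow> h j = h' j) \<Longrightarrow> path h n = path h' n"
  by (simp add: path_def)

lemma path_eqD:
  assumes "path h n = path h' n" "h 0 = h' 0" "j \<le> n"
  shows "h j = h' j"
  using assms(3)
proof (induction j)
  case (Suc j)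
  then have "path h n ! j = path h' n ! j" using assms(1) by simp
  then show ?case using Suc by simp
qed (use assms in simp)

lemma path_in_free_motzkin_iff:
  "path h n \<in> free_motzkin (int n) t \<longleftrightarrow> h n = h 0 + t \<and> (\<forall>j<n. \<bar>h (Suc j) - h j\<bar> \<le> 1)"
proof -
  have "set (path h n) = (\<lambda>j. (1, h (Suc j) - h j)) ` {..<n}"
    by (auto simp: path_def)
  moreover have "(1, z) \<in> {U, D, F} \<longleftrightarrow> \<bar>z\<bar> \<le> 1" for z :: int
    by auto
  ultimately show ?thesis
    by (auto simp: free_motzkin_def sum_list_path image_subset_iff simp del: insert_iff)
qed

lemma free_motzkin_eq_path:
  assumes "P \<in> free_motzkin (int n) t"
  shows "\<exists>h. h 0 = 0 \<and> P = path h n"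
proof -
  let ?h = "\<lambda>j. snd (sum_list (take j P))"
  have steps: "set P \<subseteq> {U, D, F}" and sum: "sum_list P = (int n, t)"
    using assms by (auto simp: free_motzkin_def)
  have "fst (sum_list P) = int (length P)" if "set P \<subseteq> {U, D, F}" for P :: "step list"
    using that by (induction P) auto
  from this[OF steps] have len: "length P = n" using sum by simp
  have "P = path ?h n"
  proof (rule nth_equalityI)
    fix j assume "j < length P"
    then have "P ! j \<in> {U, D, F}" using steps nth_mem by blast
    then have "fst (P ! j) = 1" by auto
    then show "P ! j = path ?h n ! j"
      using \<open>j < length P\<close> len by (simp add: take_Suc_conv_app_nth prod_eq_iff)
  qed (simp add: len)
  then show ?thesis by (intro exI[of _ ?h]) simp
qed

section \<open>Subwords of a path in terms of heights\<close>

lemma prefix_iff_nth: "prefix xs ys \<longleftrightarrow> length xs \<le> length ys \<and> (\<forall>i<length xs. ys ! i = xs ! i)"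
proof
  assume "prefix xs ys"
  then show "length xs \<le> length ys \<and> (\<forall>i<length xs. ys ! i = xs ! i)"
    by (auto simp: prefix_def nth_append)
next
  assume "length xs \<le> length ys \<and> (\<forall>i<length xs. ys ! i = xs ! i)"
  then have "take (length xs) ys = xs" by (auto intro!: nth_equalityI)
  then show "prefix xs ys" by (metis take_is_prefix)
qed

lemma sublist_iff_nth:
  "sublist xs ys \<longleftrightarrow> (\<exists>k. k + length xs \<le> length ys \<and> (\<forall>i<length xs. ys ! (k + i) = xs ! i))"
proof
  assume "sublist xs ys"
  then obtain us vs where "ys = us @ xs @ vs" by (auto simp: sublist_def)
  then show "\<exists>k. k + length xs \<le> length ys \<and> (\<forall>i<length xs. ys ! (k + i) = xs ! i)"
    by (intro exI[of _ "length us"]) (auto simp: nth_append)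
next
  assume "\<exists>k. k + length xs \<le> length ys \<and> (\<forall>i<length xs. ys ! (k + i) = xs ! i)"
  then obtain k where k: "k + length xs \<le> length ys" "\<forall>i<length xs. ys ! (k + i) = xs ! i" by blast
  then have "prefix xs (drop k ys)" by (auto simp: prefix_iff_nth)
  then show "sublist xs ys"
    by (metis prefix_imp_sublist sublist_drop sublist_order.order_trans)
qed

lemma suffix_iff_nth:
  "suffix xs ys \<longleftrightarrow>
     length xs \<le> length ys \<and> (\<forall>i<length xs. ys ! (length ys - length xs + i) = xs ! i)"
proof
  assume "suffix xs ys"
  then show "length xs \<le> length ys \<and> (\<forall>i<length xs. ys ! (length ys - length xs + i) = xs ! i)"
    by (auto simp: suffix_def nth_append)
next
  assume *: "length xs \<le> length ys \<and> (\<forall>i<length xs. ys ! (length ys - length xs + i) = xs ! i)"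
  then have "drop (length ys - length xs) ys = xs" by (auto intro!: nth_equalityI)
  then show "suffix xs ys" by (metis suffix_drop)
qed

lemma flat_eq:
  fixes h :: "nat \<Rightarrow> 'a"
  assumes "\<And>j. x \<le> j \<Longrightarrow> j < y \<Longrightarrow> h (Suc j) = h j" "x \<le> y"
  shows "h y = h x"
  using assms(2,1)
proof (induction y rule: dec_induct)
  case (step y)
  then have "h (Suc y) = h y" "h y = h x" by (metis lessI, metis less_SucI)
  then show ?case by simp
qed simp

text \<open>The word at \<open>x\<close> is a plateau of height \<open>h x + 1\<close> between two
  up steps. In this form it can be compared with bounds on rises.\<close>

lemma sublist_UFU_path_iff:
  "sublist ([U] @ replicate i F @ [U]) (path h n) \<longleftrightarrow>
     (\<exists>x. x + i + 2 \<le> n \<and> h (x + i + 2) = h x + 2 \<and> (\<forall>z. x < z \<and> z < x + i + 2 \<longrightarrow> h z = h x + 1))"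
  (is "_ \<longleftrightarrow> (\<exists>x. ?R x)")
proof
  assume "sublist ([U] @ replicate i F @ [U]) (path h n)"
  then obtain x where x: "x + i + 2 \<le> n"
    and nth: "\<And>k. k < i + 2 \<Longrightarrow> path h n ! (x + k) = ([U] @ replicate i F @ [U]) ! k"
    by (auto simp: sublist_iff_nth)
  have up: "h (Suc x) = h x + 1" using nth[of 0] x by simp
  have flat: "h (Suc j) = h j" if "Suc x \<le> j" "j < x + i + 1" for j
  proof -
    obtain k where "j = Suc (x + k)" using \<open>Suc x \<le> j\<close> by (metis le_Suc_ex add_Suc)
    then show ?thesis using nth[of "Suc k"] x that by (simp add: nth_append)
  qed
  have inner: "h z = h x + 1" if "x < z" "z < x + i + 2" for z
    unfolding up[symmetric] by (rule flat_eq, rule flat) (use that in linarith)+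
  have "h (x + i + 2) = h (x + i + 1) + 1"
    using nth[of "i + 1"] x by (auto simp: nth_append nth_Cons')
  moreover have "h (x + i + 1) = h x + 1" by (rule inner) auto
  ultimately have "h (x + i + 2) = h x + 2" by simp
  then show "\<exists>x. ?R x" using x inner by blast
next
  assume "\<exists>x. ?R x"
  then obtain x where x: "x + i + 2 \<le> n" "h (x + i + 2) = h x + 2"
    and flat: "\<And>z. x < z \<Longrightarrow> z < x + i + 2 \<Longrightarrow> h z = h x + 1" by auto
  have "path h n ! (x + k) = ([U] @ replicate i F @ [U]) ! k" if "k < i + 2" for k
  proof -
    have "k = 0 \<or> 0 < k \<and> k \<le> i \<or> k = i + 1" using that by linarith
    then consider "k = 0" | "0 < k" "k \<le> i" | "k = i + 1" by blast
    then show ?thesis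
      using x flat[of "x + k"] flat[of "Suc (x + k)"] by cases (auto simp: nth_append nth_Cons')
  qed
  then show "sublist ([U] @ replicate i F @ [U]) (path h n)"
    using x(1) unfolding sublist_iff_nth by (intro exI[of _ x]) simp
qed

lemma prefix_FU_path_iff:
  "prefix (replicate i F @ [U]) (path h n) \<longleftrightarrow>
     i < n \<and> h (Suc i) = h 0 + 1 \<and> (\<forall>z\<le>i. h z = h 0)" (is "_ \<longleftrightarrow> ?R")
proof
  assume "prefix (replicate i F @ [U]) (path h n)"
  then have i: "i < n" and nth: "\<And>k. k \<le> i \<Longrightarrow> path h n ! k = (replicate i F @ [U]) ! k"
    by (auto simp: prefix_iff_nth)
  have flat: "h (Suc j) = h j" if "j < i" for j
    using nth[of j] i that by (auto simp: nth_append)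
  have "h z = h 0" if "z \<le> i" for z
    by (rule flat_eq, rule flat) (use that in linarith)+
  moreover have "h (Suc i) = h i + 1" using nth[of i] i by (auto simp: nth_append)
  ultimately show ?R using i by (metis order_refl)
next
  assume ?R
  then have R: "i < n" "h (Suc i) = h 0 + 1" and flat: "\<And>z. z \<le> i \<Longrightarrow> h z = h 0" by blast+
  have "path h n ! k = (replicate i F @ [U]) ! k" if "k < Suc i" for k
    using that R flat[of k] flat[of "Suc k"] by (cases "k = i") (auto simp: nth_append)
  then show "prefix (replicate i F @ [U]) (path h n)"
    using R(1) by (simp add: prefix_iff_nth)
qed

lemma suffix_UF_path_iff:
  "suffix ([U] @ replicate i F) (path h n) \<longleftrightarrow>
     i < n \<and> h (n - Suc i) = h n - 1 \<and> (\<forall>z. n - i \<le> z \<and> z \<le> n \<longrightarrow> h z = h n)" (is "_ \<longleftrightarrow> ?R")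
proof
  assume "suffix ([U] @ replicate i F) (path h n)"
  then have i: "i < n" and nth: "\<And>k. k \<le> i \<Longrightarrow> path h n ! (n - Suc i + k) = ([U] @ replicate i F) ! k"
    by (auto simp: suffix_iff_nth)
  have flat: "h (Suc j) = h j" if "n - i \<le> j" "j < n" for j
  proof -
    have "j = n - Suc i + Suc (j - (n - i))" "Suc (j - (n - i)) \<le> i" using that i by linarith+
    then show ?thesis using nth[of "Suc (j - (n - i))"] i that by simp
  qed
  have "h n = h z" if "n - i \<le> z" "z \<le> n" for z
    by (rule flat_eq, rule flat) (use that in linarith)+
  moreover have "h (n - i) = h (n - Suc i) + 1" 
    using nth[of 0] i by (simp add: Suc_diff_Suc)
  ultimately have "h (n - Suc i) = h n - 1" by (metis add_diff_cancel_right' diff_le_self order_refl)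
  then show ?R using i \<open>\<And>z. n - i \<le> z \<Longrightarrow> z \<le> n \<Longrightarrow> h n = h z\<close> by metis
next
  assume ?R
  then have R: "i < n" "h (n - Suc i) = h n - 1"
    and flat: "\<And>z. n - i \<le> z \<Longrightarrow> z \<le> n \<Longrightarrow> h z = h n" by blast+
  have "path h n ! (n - Suc i + k) = ([U] @ replicate i F) ! k" if "k < Suc i" for k
  proof (cases k)
    case 0
    have "h (n - i) = h n" by (rule flat) auto
    then show ?thesis using R 0 by (simp add: Suc_diff_Suc)
  next
    case (Suc k')
    have "h (n - Suc i + k) = h n" "h (Suc (n - Suc i + k)) = h n"
      by (rule flat; use R(1) Suc that in linarith)+
    then show ?thesis using R Suc that by simp
  qed
  then show "suffix ([U] @ replicate i F) (path h n)"
    using R(1) by (auto simp: suffix_iff_nth)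
qed

section \<open>Forbidden subwords as bounds on heights\<close>

text \<open>A pair of positions at minimal distance whose heights differ by at least 2 spans a subpath
  \<open>U F\<^sup>i U\<close>.\<close>
lemma no_UFU_iff:
  assumes "\<And>j. j < n \<Longrightarrow> \<bar>h (Suc j) - h j\<bar> \<le> 1"
  shows "(\<forall>i. i + 2 < p \<longrightarrow> \<not> sublist ([U] @ replicate i F @ [U]) (path h n)) \<longleftrightarrow>
     (\<forall>x y. x \<le> y \<and> y \<le> n \<and> y < x + p \<longrightarrow> h y \<le> h x + 1)" (is "?L \<longleftrightarrow> ?R")
proof
  assume R: ?R
  show ?L
  proof (intro allI impI notI)
    fix i assume "i + 2 < p" "sublist ([U] @ replicate i F @ [U]) (path h n)"
    then obtain x where "x + i + 2 \<le> n" "h (x + i + 2) = h x + 2"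
      using sublist_UFU_path_iff[THEN iffD1] by blast
    then show False using R[rule_format, of x "x + i + 2"] \<open>i + 2 < p\<close> by simp
  qed
next
  assume L: ?L
  show ?R
  proof (rule ccontr)
    let ?bad = "\<lambda>k. \<exists>x. x + k \<le> n \<and> h (x + k) > h x + 1"
    assume "\<not> ?R"
    then obtain x y where xy: "x \<le> y" "y \<le> n" "y < x + p" "h y > h x + 1" by force
    then have ex: "?bad (y - x)" by (intro exI[of _ x]) simp
    define k where "k = (LEAST k. ?bad k)"
    have "?bad k" unfolding k_def using ex by (rule LeastI)
    then obtain w where w: "w + k \<le> n" "h (w + k) > h w + 1" by blast
    have "k \<le> y - x" unfolding k_def using ex by (rule Least_le)
    then have kp: "k < p" using xy by linarith
    have k_min: "h v \<le> h u + 1" if "u \<le> v" "v < u + k" "v \<le> n" for u v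
    proof (rule ccontr)
      assume "\<not> h v \<le> h u + 1"
      then have "?bad (v - u)" using that by (intro exI[of _ u]) simp
      then have "k \<le> v - u" unfolding k_def by (rule Least_le)
      then show False using that by linarith
    qed
    have "k \<noteq> 0" using w by (intro notI) simp
    moreover have "k \<noteq> 1" using w assms[of w] by (intro notI) simp
    ultimately obtain i where i: "k = i + 2" by (metis One_nat_def add_2_eq_Suc' not0_implies_Suc)
    have "h (w + k) \<le> h (Suc w) + 1" using w i by (intro k_min) auto
    then have two: "h (w + k) = h w + 2" using w assms[of w] i by simp
    \<comment> \<open>By minimality a height in between is at most \<open>h w + 1\<close> and at
      least \<open>h (w + k) - 1\<close>, which are equal.\<close>
    have "h z = h w + 1" if "w < z" "z < w + k" for z
      using k_min[of w z] k_min[of z "w + k"] that two w by simp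
    then have "sublist ([U] @ replicate i F @ [U]) (path h n)"
      using w two unfolding sublist_UFU_path_iff i by (intro exI[of _ w]) (simp add: add.assoc)
    then show False using L kp i by simp
  qed
qed

text \<open>Without the bound on rises, a path such as \<open>D U U\<close> would climb above its start without beginning
  with \<open>F\<^sup>j U\<close>.\<close>
lemma no_FU_iff:
  assumes stp: "\<And>j. j < n \<Longrightarrow> \<bar>h (Suc j) - h j\<bar> \<le> 1"
    and up: "\<And>x y. x \<le> y \<Longrightarrow> y \<le> n \<Longrightarrow> y < x + p \<Longrightarrow> h y \<le> h x + 1" and "q < p"
  shows "(\<forall>j<q. \<not> prefix (replicate j F @ [U]) (path h n)) \<longleftrightarrow> (\<forall>y\<le>n. y \<le> q \<longrightarrow> h y \<le> h 0)"
    (is "?L \<longleftrightarrow> ?R")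
proof
  assume R: ?R
  show ?L
  proof (intro allI impI notI)
    fix j assume "j < q" "prefix (replicate j F @ [U]) (path h n)"
    then have "j < n" "h (Suc j) = h 0 + 1"
      using prefix_FU_path_iff[THEN iffD1] by blast+
    then show False using R[rule_format, of "Suc j"] \<open>j < q\<close> by simp
  qed
next
  assume L: ?L
  show ?R
  proof (rule ccontr)
    assume "\<not> ?R"
    then have ex: "\<exists>y. y \<le> n \<and> y \<le> q \<and> h y > h 0" by force
    define y where "y = (LEAST y. y \<le> n \<and> y \<le> q \<and> h y > h 0)"
    have y: "y \<le> n" "y \<le> q" "h y > h 0" using LeastI_ex[OF ex] by (auto simp: y_def)
    have least: "h z \<le> h 0" if "z < y" for z
      using not_less_Least[of z "\<lambda>y. y \<le> n \<and> y \<le> q \<and> h y > h 0"] that y unfolding y_def by fastforce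
    obtain j where j: "y = Suc j" using y(3) by (cases y) auto
    have hy: "h y = h 0 + 1" using least[of j] stp[of j] y j by simp
    have "h z = h 0" if "z \<le> j" for z
      using up[of z y] least[of z] that j y hy \<open>q < p\<close> by simp
    then have "prefix (replicate j F @ [U]) (path h n)"
      using hy j y unfolding prefix_FU_path_iff by (metis Suc_le_eq)
    then show False using L j y by simp
  qed
qed

text \<open>The mirror image of \<open>no_FU_iff\<close>: walking back from the end, the first
  height below \<open>h n\<close> precedes an up step, and the bound on rises keeps all later
  heights at \<open>h n\<close>.\<close>

lemma no_UF_iff:
  assumes stp: "\<And>j. j < n \<Longrightarrow> \<bar>h (Suc j) - h j\<bar> \<le> 1"
    and up: "\<And>x y. x \<le> y \<Longrightarrow> y \<le> n \<Longrightarrow> y < x + p \<Longrightarrow> h y \<le> h x + 1" and "q < p"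
  shows "(\<forall>j<q. \<not> suffix ([U] @ replicate j F) (path h n)) \<longleftrightarrow> (\<forall>x\<le>n. n - x \<le> q \<longrightarrow> h n \<le> h x)"
    (is "?L \<longleftrightarrow> ?R")
proof
  assume R: ?R
  show ?L
  proof (intro allI impI notI)
    fix j assume "j < q" "suffix ([U] @ replicate j F) (path h n)"
    then have "j < n" "h (n - Suc j) = h n - 1"
      using suffix_UF_path_iff[THEN iffD1] by blast+
    then show False using R[rule_format, of "n - Suc j"] \<open>j < q\<close> by simp
  qed
next
  assume L: ?L
  show ?R
  proof (rule ccontr)
    let ?P = "\<lambda>k. k \<le> n \<and> k \<le> q \<and> h (n - k) < h n"
    assume "\<not> ?R"
    then obtain x where "x \<le> n" "n - x \<le> q" "h x < h n" by force
    then have ex: "\<exists>k. ?P k" by (intro exI[of _ "n - x"]) simp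
    define k where "k = (LEAST k. ?P k)"
    have k: "k \<le> n" "k \<le> q" "h (n - k) < h n" using LeastI_ex[OF ex] by (auto simp: k_def)
    have least: "h n \<le> h z" if "n - k < z" "z \<le> n" for z
    proof -
      have "n - z < k" using that by linarith
      then have "\<not> ?P (n - z)" unfolding k_def by (rule not_less_Least)
      moreover have "n - z \<le> q" using that k by linarith
      ultimately show ?thesis using \<open>z \<le> n\<close> by simp
    qed
    obtain j where j: "k = Suc j" using k(3) by (cases k) auto
    have s: "n - j = Suc (n - k)" using j k by simp
    have hk: "h (n - k) = h n - 1"
      using least[of "Suc (n - k)"] stp[of "n - k"] k s by linarith
    have "h z = h n" if "n - j \<le> z" "z \<le> n" for z
    proof -
      have "n - k < z" "n - k \<le> z" "z < n - k + p" using that j k \<open>q < p\<close> by linarith+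
      then show ?thesis using up[of "n - k" z] least[of z] that hk by linarith
    qed
    then have "suffix ([U] @ replicate j F) (path h n)"
      using hk j k unfolding suffix_UF_path_iff by (metis Suc_le_eq)
    then show False using L j k by simp
  qed
qed

section \<open>Functions with dihedral symmetry\<close>

text \<open>Below, \<open>N = s + d\<close>, \<open>M\<close> is the length of the path, \<open>b\<close> its final height, and \<open>c\<close>, \<open>e\<close> are the
  parities of \<open>s\<close> and \<open>d\<close>. The centres of symmetry of a profile are \<open>- c / 2\<close> and \<open>M - e / 2\<close>, up to
  translation by \<open>N\<close>; for \<open>e = 1\<close> the height \<open>b\<close> at \<open>M\<close> is a convention and need not be the value of
  the profile.\<close>
locale dihedral =
  fixes N d c e b :: int and M p :: nat
  assumes N: "N = 2 * int M - e + c" and d: "d = - 2 * b - e"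
    and c: "c = 0 \<or> c = 1" and e: "e = 0 \<or> e = 1" and d_pos: "0 < d" and M_pos: "0 < M"
    and p: "2 \<le> p"
begin

text \<open>The clauses come from equal labels, from the symmetry, and from the core conditions: the
  bound on drops belongs to \<open>s\<close>, the bound on rises at distance \<open>k - 1\<close> to
  \<open>s + k * d\<close>.\<close>

definition profile :: "(int \<Rightarrow> int) \<Rightarrow> bool" where
  "profile g \<longleftrightarrow> (\<forall>j. g (j + N) = g j - d) \<and> (\<forall>j. g (- c - j) = - g j) \<and>
     (\<forall>j. g j - 1 \<le> g (j + 1)) \<and> (\<forall>x y. x \<le> y \<and> y < x + int p \<longrightarrow> g y \<le> g x + 1)"

text \<open>The last two clauses bound the rise between a point and its mirror image; that of
  \<open>y\<close> in \<open>- c / 2\<close> has height \<open>- h y\<close> and distance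
  \<open>2 * y + c\<close>. For \<open>e = 1\<close> the distance to \<open>M\<close> counts, since
  the profile takes the value \<open>b + 1\<close> at \<open>M - 1\<close> or at
  \<open>M\<close>.\<close>

definition height :: "(nat \<Rightarrow> int) \<Rightarrow> bool" where
  "height h \<longleftrightarrow> h 0 = 0 \<and> h M = b \<and> (\<forall>j<M. \<bar>h (Suc j) - h j\<bar> \<le> 1) \<and>
     (\<forall>x y. x \<le> y \<and> y \<le> M \<and> y < x + p \<longrightarrow> h y \<le> h x + 1) \<and>
     (\<forall>y\<le>M. 2 * int y + c < int p \<longrightarrow> h y \<le> 0) \<and>
     (\<forall>x\<le>M. (2 - e) * int (M - x) < int p \<longrightarrow> b \<le> h x)"

section \<open>Profiles and the heights of paths\<close>

lemma height_profile:
  assumes "profile g"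
  shows "height ((\<lambda>j. g (int j))(M := b))"
proof -
  let ?h = "(\<lambda>j. g (int j))(M := b)"
  from assms have per: "g (j + N) = g j - d" and refl: "g (- c - j) = - g j"
    and down: "g j - 1 \<le> g (j + 1)" and up: "x \<le> y \<Longrightarrow> y < x + int p \<Longrightarrow> g y \<le> g x + 1" for j x y
    by (auto simp: profile_def)
  have up1: "g (j + 1) \<le> g j + 1" for j using up[of j "j + 1"] p by simp
  \<comment> \<open>Reflection in \<open>- c / 2\<close> followed by translation by \<open>N\<close>
    is reflection in the other centre \<open>M - e / 2\<close>.\<close>
  have refl': "g (2 * int M - e - j) = 2 * b + e - g j" for j
    using per[of "- c - j"] refl[of j] N d by (simp add: algebra_simps)
  \<comment> \<open>For \<open>c = 1\<close> the values at \<open>-1\<close> and \<open>0\<close>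
    are opposite and differ by at most 1.\<close>
  have g0: "g 0 = 0" using c refl[of 0] down[of "-1"] up1[of "-1"] by auto
  have gM: "g (int M) = b" if "e = 0" using refl'[of "int M"] that by simp
  have gM1: "g (int M - 1) + g (int M) = 2 * b + 1" if "e = 1"
    using refl'[of "int M"] that by simp
  have dM: "\<bar>g (int M) - g (int M - 1)\<bar> \<le> 1" using down[of "int M - 1"] up1[of "int M - 1"] by simp
  have b_neg: "b < 0" using d d_pos e by auto
  \<comment> \<open>For \<open>e = 1\<close> the values at \<open>M - 1\<close> and \<open>M\<close>
    are \<open>b\<close> and \<open>b + 1\<close> in some order.\<close>
  have gMb: "b \<le> g (int M)" "\<bar>b - g (int M - 1)\<bar> \<le> 1" using e gM gM1 dM by auto
  have "\<bar>?h (Suc j) - ?h j\<bar> \<le> 1" if "j < M" for j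
  proof (cases "Suc j = M")
    case True
    then have "int M - 1 = int j" by simp
    with gMb(2) have "\<bar>b - g (int j)\<bar> \<le> 1" by (simp only:)
    then show ?thesis using True by simp
  next
    case False
    then show ?thesis using that down[of "int j"] up1[of "int j"] by (simp add: add.commute)
  qed
  moreover have "?h y \<le> ?h x + 1" if "x \<le> y" "y \<le> M" "y < x + p" for x y
    using that up[of "int x" "int y"] gMb(1) by auto
  moreover have "?h y \<le> 0" if "y \<le> M" "2 * int y + c < int p" for y
  proof (cases "y = M")
    case True
    then show ?thesis using b_neg by simp
  next
    case False
    have "g (int y) \<le> g (- c - int y) + 1" using that c by (intro up) auto
    then show ?thesis using False refl[of "int y"] by simp
  qed
  moreover have "b \<le> ?h x" if "x \<le> M" "(2 - e) * int (M - x) < int p" for x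
  proof (cases "x = M")
    case False
    then have "x < M" using that by simp
    show ?thesis
    proof (cases "e = 0")
      case True
      have "g (2 * int M - int x) \<le> g (int x) + 1"
        using that True by (intro up) auto
      then show ?thesis using False refl'[of "int x"] True by simp
    next
      case e1: False
      then have "e = 1" using e by simp
      \<comment> \<open>The left sides add up to \<open>2 * b + 1\<close>, so the integer
        \<open>g (int x)\<close> is at least \<open>b\<close>.\<close>
      then have "g (int M) \<le> g (int x) + 1" "g (int M - 1) \<le> g (int x) + 1"
        using that \<open>x < M\<close> by (auto intro!: up)
      then show ?thesis using False gM1[OF \<open>e = 1\<close>] by simp
    qed
  qed simp
  ultimately show ?thesis using g0 M_pos by (simp add: height_def)
qed

text \<open>Here \<open>M\<close> is itself a centre of symmetry, so prescribing the height
  \<open>b\<close> there changes nothing.\<close>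

lemma profile_centre:
  assumes "profile g" "e = 0"
  shows "g (int M) = b"
proof -
  have "g (- c - int M + N) = g (- c - int M) - d" "g (- c - int M) = - g (int M)"
    using assms(1) unfolding profile_def by blast+
  moreover have "- c - int M + N = int M" using N assms(2) by simp
  ultimately show ?thesis using d assms(2) by simp
qed

text \<open>Translations and reflections move every integer into \<open>0, ..., M - 1\<close>, or to
  \<open>M\<close> if \<open>e = 0\<close>, where the value is forced.\<close>

lemma profile_eqI:
  assumes "profile g" "profile g'" "\<And>j. j < M \<Longrightarrow> g (int j) = g' (int j)"
  shows "g = g'"
proof
  fix j
  have per: "g (j + N) = g j - d" "g' (j + N) = g' j - d"
    and refl: "g (- c - j) = - g j" "g' (- c - j) = - g' j" for j
    using assms(1,2) by (auto simp: profile_def)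
  have N_pos: "0 < N" using N M_pos c e d d_pos by auto
  have per': "g (j + N * k) = g j - d * k" "g' (j + N * k) = g' j - d * k" for j k
  proof (induction k rule: int_induct[where k = 0])
    case (step1 k)
    { case 1 then show ?case using step1 per(1)[of "j + N * k"] by (simp add: algebra_simps) }
    { case 2 then show ?case using step1 per(2)[of "j + N * k"] by (simp add: algebra_simps) }
  next
    case (step2 k)
    { case 1 then show ?case using step2 per(1)[of "j + N * (k - 1)"] by (simp add: algebra_simps) }
    { case 2 then show ?case using step2 per(2)[of "j + N * (k - 1)"] by (simp add: algebra_simps) }
  qed simp_all
  have dom: "g r = g' r" if "0 \<le> r" "r < int M" for r
    using assms(3)[of "nat r"] that by simp
  have refl': "g (2 * int M - e - j) = 2 * b + e - g j" "g' (2 * int M - e - j) = 2 * b + e - g' j" for j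
    using per[of "- c - j"] refl[of j] N d by (simp_all add: algebra_simps)
  have dom2: "g r = g' r" if "0 \<le> r" "r < N" for r
  proof (cases "r < int M")
    case False
    then have "r = int M \<and> e = 0 \<or> 0 \<le> 2 * int M - e - r \<and> 2 * int M - e - r < int M \<or> r = N - 1 \<and> c = 1"
      using that N c e by presburger
    then consider "r = int M" "e = 0" | "0 \<le> 2 * int M - e - r" "2 * int M - e - r < int M" | "r = N - 1" "c = 1"
      by blast
    then show ?thesis
    proof cases
      case 1
      then show ?thesis using refl'[of r] by simp
    next
      case 2
      then show ?thesis using refl'[of r] dom[of "2 * int M - e - r"] by linarith
    next
      case 3
      then show ?thesis using per[of "-1"] refl[of 0] dom[of 0] M_pos by simp
    qed
  qed (use dom that in blast)
  have "j = j mod N + N * (j div N)" by simp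
  then show "g j = g' j"
    using per'[of "j mod N" "j div N"] dom2[of "j mod N"] N_pos by simp
qed

text \<open>Residues up to \<open>M - e\<close> are read off from \<open>h\<close>, the others
  through reflection in \<open>M - e / 2\<close>. For \<open>e = 1\<close> the point
  \<open>M\<close> is among the others, as \<open>h M\<close> is only a convention.\<close>

definition extend :: "(nat \<Rightarrow> int) \<Rightarrow> int \<Rightarrow> int" where
  "extend h j = (let r = j mod N in
     if r \<le> int M - e then h (nat r) else - d - h (nat (N - c - r))) - d * (j div N)"

text \<open>Translation and symmetry come from the construction, unit steps are checked on one
  period. A too large rise at minimal distance either avoids the centres and can be moved into the
  path, or straddles one, where the heights near the ends exclude it.\<close>

lemma profile_extend:
  assumes "height h"
  shows "profile (extend h)" "\<And>j. int j \<le> int M - e \<Longrightarrow> extend h (int j) = h j"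
proof -
  define g where "g = extend h"
  have N_pos: "0 < N" using N M_pos c e d d_pos by auto
  from assms have h0: "h 0 = 0" and hM: "h M = b" and stp: "j < M \<Longrightarrow> \<bar>h (Suc j) - h j\<bar> \<le> 1"
    and up: "x \<le> y \<Longrightarrow> y \<le> M \<Longrightarrow> y < x + p \<Longrightarrow> h y \<le> h x + 1"
    and left: "y \<le> M \<Longrightarrow> 2 * int y + c < int p \<Longrightarrow> h y \<le> 0"
    and right: "x \<le> M \<Longrightarrow> (2 - e) * int (M - x) < int p \<Longrightarrow> b \<le> h x" for x y j
    by (auto simp: height_def)
  have b_neg: "b < 0" using d d_pos e by auto
  have base: "g (int j) = h j" if "int j \<le> int M - e" for j
  proof -
    have "int j < N" using that N c e M_pos by auto
    then show ?thesis using that by (simp add: g_def extend_def)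
  qed
  have base': "g j = h (nat j)" if "0 \<le> j" "j \<le> int M - e" for j
    using base[of "nat j"] that by simp
  have per': "g (j + N * k) = g j - d * k" for j k
  proof -
    have "(j + N * k) mod N = j mod N" "(j + N * k) div N = j div N + k" using N_pos by auto
    then show ?thesis unfolding g_def extend_def by (simp only: right_diff_distrib distrib_left diff_diff_add)
  qed
  have per: "g (j + N) = g j - d" for j using per'[of j 1] by simp
  have refl: "g (- c - j) = - g j" for j
  proof -
    define r q where "r = j mod N" and "q = j div N"
    have r: "0 \<le> r" "r < N" using N_pos by (auto simp: r_def)
    have j: "j = r + N * q" by (simp add: r_def q_def)
    have G: "g (r + N * q) = (if r \<le> int M - e then h (nat r) else - d - h (nat (N - c - r))) - d * q"
      if "0 \<le> r" "r < N" for r q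
      using that by (simp add: g_def extend_def Let_def)
    show ?thesis
    proof (cases "N - c - r < N")
      case True
      have mj: "- c - j = (N - c - r) + N * (- q - 1)" by (simp add: j algebra_simps)
      moreover have "0 \<le> N - c - r" using r c by auto
      ultimately have 1: "g (- c - j) = (if N - c - r \<le> int M - e then h (nat (N - c - r)) else - d - h (nat r)) - d * (- q - 1)"
        using G[of "N - c - r" "- q - 1"] True by (simp add: mj)
      have 2: "g j = (if r \<le> int M - e then h (nat r) else - d - h (nat (N - c - r))) - d * q"
        using G[of r q] r j by simp
      \<comment> \<open>The residues add up to \<open>2 * M - e\<close>, so both lie on the same
        side of \<open>M - e\<close> only if both are \<open>M\<close> and \<open>e = 0\<close>;
        then \<open>h M = b\<close> reconciles the formulas.\<close>
      show ?thesis
      proof (cases "r \<le> int M - e \<longleftrightarrow> N - c - r \<le> int M - e")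
        case True
        then have "r = int M" "e = 0" "N - c - r = int M" using N e r by auto
        then show ?thesis using 1 2 hM d by (simp add: algebra_simps)
      next
        case False
        then show ?thesis using 1 2 by (auto simp: algebra_simps)
      qed
    next
      case False
      then have "r = 0" "c = 0" using r c by auto
      then have "- c - j = 0 + N * (- q)" "j = 0 + N * q" using j by auto
      then show ?thesis using G[of 0 q] G[of 0 "- q"] N_pos h0 M_pos e by auto
    qed
  qed
  have refl': "g (2 * int M - e - j) = 2 * b + e - g j" for j
  proof -
    have "2 * int M - e - j = (- c - j) + N" using N by simp
    then show ?thesis using per[of "- c - j"] refl[of j] d by (simp only:)
  qed
  have g0: "g 0 = 0" using base[of 0] h0 M_pos e by auto
  have gM: "g (int M) = b" if "e = 0" using base[of M] hM that by simp
  \<comment> \<open>The end condition at distance 1 and the last step leave only \<open>b\<close>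
    and \<open>b + 1\<close> for \<open>h (M - 1)\<close>; reflection gives the value at
    \<open>M\<close>.\<close>
  have gM1: "g (int M - 1) + g (int M) = 2 * b + 1" "b \<le> g (int M)" "g (int M) \<le> b + 1" if "e = 1"
  proof -
    show 1: "g (int M - 1) + g (int M) = 2 * b + 1" using refl'[of "int M"] that by simp
    have "g (int M - 1) = h (M - 1)" using base[of "M - 1"] that M_pos by (simp add: of_nat_diff)
    moreover have "\<bar>h M - h (M - 1)\<bar> \<le> 1" using stp[of "M - 1"] M_pos by simp
    moreover have "b \<le> h (M - 1)" using right[of "M - 1"] that p M_pos by simp
    ultimately show "b \<le> g (int M)" "g (int M) \<le> b + 1" using 1 hM by auto
  qed
  have step: "\<bar>g (x + 1) - g x\<bar> \<le> 1" for x
  proof -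
    have dom: "\<bar>g (x + 1) - g x\<bar> \<le> 1" if "0 \<le> x" "x + 1 \<le> int M - e" for x
      using stp[of "nat x"] base'[of x] base'[of "x + 1"] that e by (auto simp: nat_add_distrib)
    have dom2: "\<bar>g (x + 1) - g x\<bar> \<le> 1" if x: "0 \<le> x" "x < N" for x
    proof -
      have "x + 1 \<le> int M - e \<or> int M \<le> x \<and> x + 1 \<le> N - c \<or> x = int M - 1 \<and> e = 1 \<or> c = 1 \<and> x = N - 1"
        using x N c e by presburger
      then consider "x + 1 \<le> int M - e" | "int M \<le> x" "x + 1 \<le> N - c" | "x = int M - 1" "e = 1"
        | "c = 1" "x = N - 1"
        by blast
      then show ?thesis
      proof cases
        case 2
        have "2 * int M - e - (x + 1) + 1 = 2 * int M - e - x" by simp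
        then have "\<bar>g (2 * int M - e - x) - g (2 * int M - e - (x + 1))\<bar> \<le> 1"
          using dom[of "2 * int M - e - (x + 1)"] 2 N by (simp only:)
        then show ?thesis using refl'[of x] refl'[of "x + 1"] by linarith
      next
        case 3
        then show ?thesis using gM1 by auto
      next
        case 4
        then show ?thesis using per[of 0] refl[of 0] per[of "-1"] g0 by auto
      qed (use dom x in blast)
    qed
    have "x = x mod N + N * (x div N)" "x + 1 = (x mod N + 1) + N * (x div N)" by simp_all
    then have "g (x + 1) - g x = g (x mod N + 1) - g (x mod N)"
      using per'[of "x mod N" "x div N"] per'[of "x mod N + 1" "x div N"] by simp
    then show ?thesis using dom2[of "x mod N"] N_pos by simp
  qed
  have no_bad: "g y \<le> g x + 1" if "x \<le> y" "y < x + int p" for x y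
  proof (rule ccontr)
    let ?bad = "\<lambda>n. \<exists>x. g (x + int n) > g x + 1"
    assume "\<not> g y \<le> g x + 1"
    then have ex: "?bad (nat (y - x))" using that by (auto intro!: exI[of _ x])
    \<comment> \<open>Minimality is over all integer starting points, so it survives translation and
      reflection.\<close>
    define n where "n = (LEAST n. ?bad n)"
    have "?bad n" unfolding n_def using ex by (rule LeastI)
    then obtain x\<^sub>0 where x0: "g (x\<^sub>0 + int n) > g x\<^sub>0 + 1" by blast
    have "n \<le> nat (y - x)" unfolding n_def using ex by (rule Least_le)
    then have n_lt: "int n < int p" using that by linarith
    have n_min: "g v \<le> g u + 1" if "u \<le> v" "v < u + int n" for u v
    proof -
      have "nat (v - u) < n" using that by linarith
      then have "\<not> ?bad (nat (v - u))" unfolding n_def by (rule not_less_Least)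
      then have "\<not> g (u + int (nat (v - u))) > g u + 1" by blast
      then show ?thesis using that by simp
    qed
    have n2: "2 \<le> n"
    proof (rule ccontr)
      assume "\<not> 2 \<le> n"
      then have "n = 0 \<or> n = 1" by linarith
      then show False using x0 step[of x\<^sub>0] by auto
    qed
    \<comment> \<open>A minimal violation is a plateau between two up steps, because shorter pairs
      squeeze the values in between.\<close>
    have two: "g (x + int n) = g x + 2" and inner: "\<And>z. x < z \<Longrightarrow> z < x + int n \<Longrightarrow> g z = g x + 1"
      if bad: "g (x + int n) > g x + 1" for x
    proof -
      have "g (x + int n) \<le> g (x + 1) + 1" using n2 by (intro n_min) auto
      then show t: "g (x + int n) = g x + 2" using bad step[of x] by linarith
      show "g z = g x + 1" if "x < z" "z < x + int n" for z
        using n_min[of x z] n_min[of z "x + int n"] that t by linarith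
    qed
    have left_bad: False if x: "x \<le> -1" "x + int n > - c" and bad: "g (x + int n) > g x + 1" for x
    proof -
      define y where "y = x + int n"
      note t = two[OF bad, folded y_def] and inn = inner[OF bad, folded y_def]
      \<comment> \<open>The mirror image of an end strictly inside would be on the plateau, against
        parity. So the pair is symmetric.\<close>
      have "\<not> (x < - c - x \<and> - c - x < y)" 
        using inn[of "- c - x"] refl[of x] by presburger
      moreover have "\<not> (x < - c - y \<and> - c - y < y)"
        using inn[of "- c - y"] refl[of y] t by presburger
      ultimately have y: "y = - c - x" using x c unfolding y_def by auto
      have gy: "g y = 1" "g x = - 1" using t refl[of x] y by auto
      have y_pos: "0 < y" 
        using gy(1) g0 x c unfolding y_def by (cases "y = 0") (auto simp: y_def)
      show False
      proof (cases "y \<le> int M - e")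
        case True
        have "2 * int (nat y) + c < int p" using y y_pos n_lt unfolding y_def by simp
        moreover have "nat y \<le> M" using True e by auto
        ultimately show False using left[of "nat y"] base'[of y] True y_pos gy by simp
      next
        case False
        \<comment> \<open>The plateau, here of height 0, reaches the other centre, where the values
          are \<open>b\<close> or \<open>b + 1\<close> with \<open>b < 0\<close>. Only
          \<open>b = -1\<close> and \<open>e = 1\<close> remain, and then the value
          \<open>-1\<close> at \<open>M\<close> is too low.\<close>
        then have Mi: "x < int M - e" "int M - e < y" using x M_pos e by auto
        have "g (int M - e) = 0" using inn[OF Mi] gy by simp
        then have "e = 1" "g (int M - 1) = 0" using gM b_neg e by auto
        then have "b = -1" "g (int M) = - 1" using gM1 b_neg by auto
        moreover have "int M = y \<or> g (int M) = 0" using inn[of "int M"] Mi \<open>e = 1\<close> gy by fastforce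
        ultimately show False using gy by auto
      qed
    qed
    define x y where "x = x\<^sub>0 mod N" and "y = x + int n"
    have x: "0 \<le> x" "x < N" using N_pos by (auto simp: x_def)
    have "x\<^sub>0 = x + N * (x\<^sub>0 div N)" "x\<^sub>0 + int n = y + N * (x\<^sub>0 div N)"
      by (simp_all add: x_def y_def)
    then have bad: "g y > g x + 1"
      using x0 per'[of x "x\<^sub>0 div N"] per'[of y "x\<^sub>0 div N"] by simp
    note t = two[OF bad[unfolded y_def], folded y_def] and inn = inner[OF bad[unfolded y_def], folded y_def]
    have xy: "x < y" using n2 by (simp add: y_def)
    have y: "y \<le> N - c"
    proof (rule ccontr)
      assume "\<not> y \<le> N - c"
      then show False
        using left_bad[of "x - N"] x bad per[of "x - N"] per[of "y - N"] by (auto simp: y_def algebra_simps)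
    qed
    have dom: False if "0 \<le> u" "u < v" "v \<le> int M - e" "v = u + int n" "g v > g u + 1" for u v
    proof -
      have "h (nat v) \<le> h (nat u) + 1" using that n_lt e by (intro up) auto
      then show False using base'[of u] base'[of v] that by simp
    qed
    consider "y \<le> int M - e" | "int M \<le> x" | "x < int M" "int M - e < y" by linarith
    then show False
    proof cases
      case 1
      then show False using dom[of x y] x xy bad by (simp add: y_def)
    next
      case 2
      then show False
        using dom[of "2 * int M - e - y" "2 * int M - e - x"] y N xy bad refl'[of x] refl'[of y]
        by (simp add: y_def)
    next
      case 3
      show False
      proof (cases "e = 0")
        case True
        have refl0: "g (2 * int M - z) = 2 * b - g z" for z using refl'[of z] True by simp
        \<comment> \<open>The parity argument now makes the pair symmetric about \<open>M\<close>;
          then \<open>g x = b - 1\<close>, against the end condition.\<close>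
        have "\<not> (x < 2 * int M - x \<and> 2 * int M - x < y)"
          using inn[of "2 * int M - x"] refl0[of x] by presburger
        moreover have "\<not> (x < 2 * int M - y \<and> 2 * int M - y < y)"
          using inn[of "2 * int M - y"] refl0[of y] t by presburger
        ultimately have ys: "y = 2 * int M - x" using 3 True by linarith
        then have "g x = b - 1" using t refl'[of x] True by simp
        moreover have "b \<le> h (nat x)"
          using right[of "nat x"] 3 x True ys n_lt unfolding y_def by simp
        ultimately show False using base'[of x] x 3 True by simp
      next
        case False
        then have e1: "e = 1" using e by simp
        \<comment> \<open>The value at \<open>M\<close> is at most \<open>b + 1\<close>, so a rise
          by 2 would start below \<open>b\<close>.\<close>
        have no: False if "u + int n = int M" "0 \<le> u" "g (int M) > g u + 1" for u
        proof -
          have "g (int M) = g u + 2" using two[of u] that by simp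
          moreover have "b \<le> h (nat u)" using right[of "nat u"] that n_lt e1 by simp
          moreover have "g u = h (nat u)" using base'[of u] that e1 n2 by simp
          ultimately show False using gM1 e1 by simp
        qed
        \<comment> \<open>The values at \<open>M - 1\<close> and \<open>M\<close> have an odd sum,
          so these points are not both on the plateau.\<close>
        have "x = int M - 1 \<or> y = int M"
          using inn[of "int M - 1"] inn[of "int M"] gM1(1)[OF e1] 3 e1 by presburger
        then show False
        proof
          assume "y = int M"
          then show False using no[of x] x bad by (simp add: y_def)
        next
          assume xM: "x = int M - 1"
          \<comment> \<open>Reflection turns a pair starting at \<open>M - 1\<close> into one ending
            at \<open>M\<close>.\<close>
          have "2 * int M - e - y = int M - int n" "2 * int M - e - x = int M"
            using xM e1 by (simp_all add: y_def)
          then have "g (int M - int n) = 2 * b + e - g y" "g (int M) = 2 * b + e - g x"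
            using refl'[of y] refl'[of x] by (simp_all only:)
          then show False
            using no[of "int M - int n"] xM y N e1 bad by (simp add: y_def)
        qed
      qed
    qed
  qed
  have "g j - 1 \<le> g (j + 1)" for j using step[of j] by linarith
  then show "profile (extend h)" using per refl no_bad by (auto simp: profile_def simp flip: g_def)
  show "extend h (int j) = h j" if "int j \<le> int M - e" for j
    using base[OF that] by (simp add: g_def)
qed

end

section \<open>The abacus\<close>

lemma down_closed_int:
  fixes P :: "int \<Rightarrow> bool"
  assumes down: "\<And>i. P i \<Longrightarrow> P (i - 1)" and "P a" and bound: "\<And>i. P i \<Longrightarrow> i \<le> B"
  shows "\<exists>m. \<forall>i. P i \<longleftrightarrow> i \<le> m"
proof -
  let ?A = "{i \<in> {a..B}. P i}"
  define m where "m = Max ?A"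
  have fin: "finite ?A" by (rule finite_subset[of _ "{a..B}"]) auto
  have "a \<in> ?A" using assms by auto
  then have m: "m \<in> ?A" unfolding m_def by (intro Max_in fin) blast
  have "i \<le> m" if "P i" for i
  proof (cases "a \<le> i")
    case True
    then have "i \<in> ?A" using that bound by auto
    then show ?thesis unfolding m_def by (rule Max_ge[OF fin])
  qed (use m in auto)
  moreover have "P i" if "i \<le> m" for i
    using that by (induction i rule: int_le_induct) (use m down in auto)
  ultimately show ?thesis by blast
qed

locale abacus =
  fixes s d p :: nat
  assumes s_pos: "0 < s" and d_pos: "0 < d" and coprime_sd: "coprime s d" and two_le_p: "2 \<le> p"
begin

abbreviation "c \<equiv> (if odd s then 1 else 0 :: int)"
abbreviation "e \<equiv> (if odd d then 1 else 0 :: int)"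
abbreviation "M \<equiv> s div 2 + (d + 1) div 2"
abbreviation "b \<equiv> - int ((d + 1) div 2)"

lemma odd_or_odd: "odd s \<or> odd d"
  using coprime_sd by (metis coprime_common_divisor_nat nat_dvd_1_iff_1 numeral_eq_one_iff semiring_norm(85))

sublocale dihedral "int (s + d)" "int d" c e b M p
proof
  show "int (s + d) = 2 * int M - e + c"
    using odd_or_odd by (auto elim!: evenE oddE; presburger)
  show "int d = - 2 * b - e" by (auto elim!: evenE oddE)
  show "0 < M" using d_pos by (cases d) auto
qed (use d_pos two_le_p in auto)

text \<open>Columns run over all integers: every odd number is then a label, and its positions
  differ by multiples of \<open>(d, - (s + d))\<close>.\<close>

definition lab :: "int \<Rightarrow> int \<Rightarrow> int" where
  "lab i j = abacus_a s d + 2 * int (s + d) * i + 2 * int d * j"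

lemma abacus_label_eq: "abacus_label s d i j = lab i (int j)"
  by (simp add: abacus_label_def lab_def)

lemma odd_lab: "odd (lab i j)"
  using odd_or_odd by (auto simp: lab_def abacus_a_def)

lemma uminus_lab: "- lab i j = lab (1 - i) (- c - j)"
  by (auto simp: lab_def abacus_a_def algebra_simps)

text \<open>The move tested by the core condition for \<open>s + k * d\<close> lowers the row by 1
  and the column by \<open>k - 1\<close>; hence \<open>k \<le> p\<close> becomes a bound on rises at
  distance below \<open>p\<close>.\<close>

lemma lab_minus: "lab i j - 2 * int (s + k * d) = lab (i - 1) (j - (int k - 1))"
  by (simp add: lab_def algebra_simps)

lemma lab_shift: "lab i (j + int (s + d) * t) = lab (i + int d * t) j"
  by (simp add: lab_def algebra_simps)

lemma coprime_int: "coprime (int (s + d)) (int d)"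
  using coprime_sd unfolding coprime_int_iff by (simp add: coprime_iff_gcd_eq_1)

lemma ex_lab:
  assumes "odd z"
  shows "\<exists>i j. z = lab i j"
proof -
  have "even (z - abacus_a s d)" using assms odd_lab[of 0 0] by (simp add: lab_def)
  then obtain w where w: "z - abacus_a s d = 2 * w" by blast
  obtain u v where uv: "u * int (s + d) + v * int d = 1"
    using coprime_int bezout_int by (metis coprime_iff_gcd_eq_1)
  have "lab (u * w) (v * w) = abacus_a s d + 2 * (w * (u * int (s + d) + v * int d))"
    by (simp add: lab_def algebra_simps)
  then have "z = lab (u * w) (v * w)" using uv w by simp
  then show ?thesis by blast
qed

lemma lab_eqD:
  assumes "lab i j = lab i' j'"
  obtains t where "j' = j + int (s + d) * t" "i = i' + int d * t"
proof -
  have eq: "int (s + d) * (i - i') = int d * (j' - j)"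
    using assms by (simp add: lab_def algebra_simps)
  then have "int (s + d) dvd int d * (j' - j)" by (metis dvd_triv_left)
  then have "int (s + d) dvd j' - j" using coprime_int by (simp add: coprime_dvd_mult_right_iff)
  then obtain t where t: "j' - j = int (s + d) * t" by blast
  then have "int (s + d) * (i - i') = int (s + d) * (int d * t)" using eq by simp
  then have "i - i' = int d * t" using d_pos by (subst (asm) mult_cancel_left) auto
  then show thesis using t by (intro that[of t]) auto
qed

section \<open>Core partitions, their profiles and their paths\<close>

definition profile_of :: "nat list \<Rightarrow> (int \<Rightarrow> int) \<Rightarrow> bool" where
  "profile_of xs g \<longleftrightarrow> (\<forall>i j. lab i j \<in> maya xs \<longleftrightarrow> i \<le> g j)"

lemma profile_ofD: "profile_of xs g \<Longrightarrow> lab i j \<in> maya xs \<longleftrightarrow> i \<le> g j"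
  by (simp add: profile_of_def)

abbreviation "cores \<equiv> SC (map (\<lambda>k. s + k * d) [0..<p + 1])"

lemma cores_iff:
  "xs \<in> cores \<longleftrightarrow> is_partition xs \<and> self_conjugate xs \<and>
     (\<forall>k\<le>p. \<forall>z\<in>maya xs. z - 2 * int (s + k * d) \<in> maya xs)"
proof -
  have "is_core (s + k * d) xs \<longleftrightarrow> (\<forall>z\<in>maya xs. z - 2 * int (s + k * d) \<in> maya xs)"
    if "is_partition xs" "self_conjugate xs" for k
    using that s_pos by (intro is_core_iff_maya) auto
  then show ?thesis unfolding SC_def by (fastforce simp: less_Suc_eq_le)
qed

text \<open>The case \<open>k = 1\<close> makes the elements in each column an initial segment of
  rows, whose top defines \<open>g\<close>. Equal labels, the symmetry of \<open>maya\<close> and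
  the other \<open>k\<close> give the clauses of \<open>profile\<close>.\<close>

lemma ex_profile:
  assumes "xs \<in> cores"
  shows "\<exists>g. profile g \<and> profile_of xs g"
proof -
  have part: "is_partition xs" "self_conjugate xs"
    and closed: "\<And>k z. k \<le> p \<Longrightarrow> z \<in> maya xs \<Longrightarrow> z - 2 * int (s + k * d) \<in> maya xs"
    using assms unfolding cores_iff by blast+
  have step: "lab (i - 1) (j - (int k - 1)) \<in> maya xs" if "lab i j \<in> maya xs" "k \<le> p" for i j k
    using closed[OF that(2,1)] unfolding lab_minus .
  have "\<exists>m. \<forall>i. lab i j \<in> maya xs \<longleftrightarrow> i \<le> m" for j
  proof (rule down_closed_int)
    show "lab (i - 1) j \<in> maya xs" if "lab i j \<in> maya xs" for i
      using step[OF that, of 1] two_le_p by simp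
    \<comment> \<open>In rows beyond \<open>K\<close> the labels exceed all elements of
      \<open>maya xs\<close>; in row \<open>- K\<close> even the negated label does.\<close>
    define K where "K = 2 * int (row xs 0) + \<bar>lab 0 j\<bar> + 1"
    have lin: "lab i j = lab 0 j + 2 * int (s + d) * i" for i by (simp add: lab_def)
    have linK: "lab (- K) j = lab 0 j - 2 * int (s + d) * K" using lin[of "- K"] by simp
    have big: "K \<le> 2 * int (s + d) * K" 
    proof -
      have "1 * K \<le> (2 * int (s + d)) * K" using s_pos by (intro mult_right_mono) (auto simp: K_def)
      then show ?thesis by simp
    qed
    have "- lab (- K) j > 2 * int (row xs 0)" using linK big unfolding K_def by linarith
    then have "- lab (- K) j \<notin> maya xs" using maya_le[OF part(1)] by fastforce
    then show "lab (- K) j \<in> maya xs" using maya_uminus[OF part odd_lab] by blast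
    show "i \<le> K" if "lab i j \<in> maya xs" for i
    proof (rule ccontr)
      assume "\<not> i \<le> K"
      then have "2 * int (s + d) * K \<le> 2 * int (s + d) * i" by (intro mult_left_mono) auto
      then have "lab i j > 2 * int (row xs 0)" using lin[of i] big unfolding K_def by linarith
      then show False using maya_le[OF part(1) that] by simp
    qed
  qed
  then obtain g where g: "\<And>i j. lab i j \<in> maya xs \<longleftrightarrow> i \<le> g j" by metis
  have "g (j + int (s + d)) = g j - int d" for j
  proof -
    have "i \<le> g (j + int (s + d)) \<longleftrightarrow> i + int d \<le> g j" for i
      using lab_shift[of i j 1] g by (metis mult.right_neutral)
    from this[of "g (j + int (s + d))"] this[of "g j - int d"] show ?thesis by simp
  qed
  moreover have "g (- c - j) = - g j" for j
  proof -
    have "i \<le> g (- c - j) \<longleftrightarrow> \<not> 1 - i \<le> g j" for i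
      using uminus_lab[of "1 - i" j] maya_uminus[OF part odd_lab, of "1 - i" j] g by simp
    from this[of "g (- c - j)"] this[of "- g j"] show ?thesis by linarith
  qed
  moreover have "g j - 1 \<le> g (j + 1)" for j
    using step[of "g j" j 0] g by simp
  moreover have "g y \<le> g x + 1" if "x \<le> y" "y < x + int p" for x y
  proof -
    define k where "k = nat (y - x + 1)"
    have k: "int k = y - x + 1" using that by (simp add: k_def)
    then have "k \<le> p" using that by linarith
    moreover have "y - (int k - 1) = x" using k by simp
    ultimately show ?thesis using step[of "g y" y k] g by simp
  qed
  ultimately have "profile g" unfolding profile_def by blast
  moreover have "profile_of xs g" using g unfolding profile_of_def by blast
  ultimately show ?thesis by blast
qed

text \<open>On positive labels the beads are the elements of \<open>maya xs\<close>, on negative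
  labels the spacers are, by symmetry. Both cases of \<open>abacus_fun\<close> therefore select the
  largest row of an element.\<close>

lemma abacus_fun_eq:
  assumes "is_partition xs" "self_conjugate xs" "profile_of xs g"
  shows "abacus_fun s d xs j = g (int j)"
proof -
  let ?l = "\<lambda>i. lab i (int j)"
  have mono: "?l i \<le> ?l k \<longleftrightarrow> i \<le> k" for i k using s_pos by (simp add: lab_def)
  have nz: "?l i \<noteq> 0" for i using odd_lab[of i "int j"] by auto
  have bead: "bead s d xs i j \<longleftrightarrow> (if 0 < ?l i then i \<le> g (int j) else \<not> i \<le> g (int j))" for i
    using MD_eq_maya[OF assms(2)] maya_uminus[OF assms(1,2) odd_lab, of i "int j"] nz[of i]
      profile_ofD[OF assms(3), of i "int j"]
    by (auto simp: bead_def abacus_label_eq abs_if)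
  show ?thesis
  proof (cases "\<exists>i. 0 < ?l i \<and> bead s d xs i j")
    case True
    then obtain i where i: "0 < ?l i" "i \<le> g (int j)" using bead by metis
    then have pos: "0 < ?l (g (int j))" using mono[of i "g (int j)"] by linarith
    have "(GREATEST i. bead s d xs i j) = g (int j)"
    proof (rule Greatest_equality)
      show "bead s d xs (g (int j)) j" using bead pos by simp
      \<comment> \<open>A bead with a negative label would have a row index above
        \<open>g (int j)\<close>, where labels are already positive.\<close>
      show "i \<le> g (int j)" if "bead s d xs i j" for i
        using that pos bead[of i] mono[of "g (int j)" i] by (auto split: if_splits)
    qed
    then show ?thesis using True by (simp add: abacus_fun_def abacus_label_eq)
  next
    case False
    then have "\<not> 0 < ?l (g (int j))" using bead[of "g (int j)"] by auto
    then have neg: "?l (g (int j)) < 0" using nz[of "g (int j)"] by linarith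
    have "(GREATEST i. ?l i < 0 \<and> \<not> bead s d xs i j) = g (int j)"
    proof (rule Greatest_equality)
      show "?l (g (int j)) < 0 \<and> \<not> bead s d xs (g (int j)) j" using bead neg by simp
      show "i \<le> g (int j)" if "?l i < 0 \<and> \<not> bead s d xs i j" for i
        using that bead[of i] by auto
    qed
    then show ?thesis unfolding abacus_fun_def abacus_label_eq if_not_P[OF False] .
  qed
qed

text \<open>For odd \<open>d\<close> the value at \<open>M\<close> is set to \<open>b\<close> by
  definition, for even \<open>d\<close> it is \<open>b\<close> by
  \<open>profile_centre\<close>.\<close>

lemma \<phi>_eq_path:
  assumes "is_partition xs" "self_conjugate xs" "profile g" "profile_of xs g"
  shows "\<phi> s d xs = path ((\<lambda>j. g (int j))(M := b)) M"
proof -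
  have "[1..<M + 1] = map Suc [0..<M]" by (simp add: map_Suc_upt del: upt_Suc)
  then have "\<phi> s d xs = path (abacus_fun_ext s d xs) M" by (simp add: \<phi>_def path_def)
  also have "\<dots> = path ((\<lambda>j. g (int j))(M := b)) M"
    using abacus_fun_eq[OF assms(1,2,4)] profile_centre[OF assms(3)]
    by (intro path_cong) (auto simp: abacus_fun_ext_def)
  finally show ?thesis .
qed

text \<open>As \<open>s\<close> and \<open>d\<close> are not both even, the three parity cases merge
  into one bound for each end of the path.\<close>

lemma admissible_path_iff:
  assumes "h 0 = 0"
  shows "path h M \<in> {P \<in> free_motzkin (int (s div 2 + (d + 1) div 2)) (- int ((d + 1) div 2)).
       (3 \<le> p \<longrightarrow> (\<forall>i\<le>p - 3. \<not> sublist ([U] @ replicate i F @ [U]) P)) \<and>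
       (odd s \<and> even d \<longrightarrow>
          (4 \<le> p \<longrightarrow> (\<forall>j\<le>(p - 4) div 2. \<not> prefix (replicate j F @ [U]) P)) \<and>
          (3 \<le> p \<longrightarrow> (\<forall>k\<le>(p - 3) div 2. \<not> suffix ([U] @ replicate k F) P))) \<and>
       (odd s \<and> odd d \<longrightarrow>
          (4 \<le> p \<longrightarrow> (\<forall>j\<le>(p - 4) div 2. \<not> prefix (replicate j F @ [U]) P)) \<and>
          (\<forall>k\<le>p - 2. \<not> suffix ([U] @ replicate k F) P)) \<and>
       (even s \<and> odd d \<longrightarrow>
          (3 \<le> p \<longrightarrow> (\<forall>j\<le>(p - 3) div 2. \<not> prefix (replicate j F @ [U]) P)) \<and>
          (\<forall>k\<le>p - 2. \<not> suffix ([U] @ replicate k F) P))} \<longleftrightarrow> height h" (is "?l \<longleftrightarrow> _")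
proof -
  let ?P = "path h M"
  let ?steps = "\<forall>j<M. \<bar>h (Suc j) - h j\<bar> \<le> 1"
  let ?up = "\<forall>x y. x \<le> y \<and> y \<le> M \<and> y < x + p \<longrightarrow> h y \<le> h x + 1"
  let ?noUFU = "\<forall>i. i + 2 < p \<longrightarrow> \<not> sublist ([U] @ replicate i F @ [U]) ?P"
  have free: "?P \<in> free_motzkin (int M) b \<longleftrightarrow> h M = b \<and> ?steps"
    unfolding path_in_free_motzkin_iff using assms by simp
  have no_UFU: "?noUFU \<longleftrightarrow> ?up" if ?steps
    using that by (intro no_UFU_iff) blast
  \<comment> \<open>\<open>q\<^sub>1\<close> is the largest \<open>y\<close> with
    \<open>2 * y + c < p\<close>, and \<open>q\<^sub>2\<close> the largest \<open>k\<close> with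
    \<open>(2 - e) * k < p\<close>; both also count the words forbidden at that end.\<close>
  define q\<^sub>1 where "q\<^sub>1 = (if odd s then (p - 2) div 2 else (p - 1) div 2)"
  define q\<^sub>2 where "q\<^sub>2 = (if odd d then p - 1 else (p - 1) div 2)"
  have q: "q\<^sub>1 < p" "q\<^sub>2 < p" using two_le_p by (auto simp: q\<^sub>1_def q\<^sub>2_def)
  have 1: "3 \<le> p \<and> i \<le> p - 3 \<longleftrightarrow> i + 2 < p" for i using two_le_p by auto
  have 2: "4 \<le> p \<and> j \<le> (p - 4) div 2 \<longleftrightarrow> j < (p - 2) div 2"
    "3 \<le> p \<and> j \<le> (p - 3) div 2 \<longleftrightarrow> j < (p - 1) div 2"
    "j \<le> p - 2 \<longleftrightarrow> j < p - 1" for j using two_le_p by linarith+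
  have "?l \<longleftrightarrow> ?P \<in> free_motzkin (int M) b \<and>
      (\<forall>i. i + 2 < p \<longrightarrow> \<not> sublist ([U] @ replicate i F @ [U]) ?P) \<and>
      (\<forall>j<q\<^sub>1. \<not> prefix (replicate j F @ [U]) ?P) \<and>
      (\<forall>k<q\<^sub>2. \<not> suffix ([U] @ replicate k F) ?P)"
    using odd_or_odd unfolding q\<^sub>1_def q\<^sub>2_def 1[symmetric]
    by (cases "odd s"; cases "odd d") (simp_all only: 2[symmetric] mem_Collect_eq simp_thms if_True if_False, (meson | blast)+)
  also have "\<dots> \<longleftrightarrow> (h M = b \<and> ?steps) \<and> ?up \<and>
      (\<forall>y\<le>M. y \<le> q\<^sub>1 \<longrightarrow> h y \<le> 0) \<and> (\<forall>x\<le>M. M - x \<le> q\<^sub>2 \<longrightarrow> b \<le> h x)"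
  proof (cases "h M = b \<and> ?steps \<and> ?up")
    case True
    then have hM: "h M = b" and stp: ?steps and stp': "\<And>j. j < M \<Longrightarrow> \<bar>h (Suc j) - h j\<bar> \<le> 1"
      and up': "\<And>x y. x \<le> y \<Longrightarrow> y \<le> M \<Longrightarrow> y < x + p \<Longrightarrow> h y \<le> h x + 1" by blast+
    have "(\<forall>j<q\<^sub>1. \<not> prefix (replicate j F @ [U]) ?P) \<longleftrightarrow> (\<forall>y\<le>M. y \<le> q\<^sub>1 \<longrightarrow> h y \<le> 0)"
      using no_FU_iff[of M h p q\<^sub>1, OF stp' up' q(1)] unfolding assms .
    moreover have "(\<forall>k<q\<^sub>2. \<not> suffix ([U] @ replicate k F) ?P) \<longleftrightarrow> (\<forall>x\<le>M. M - x \<le> q\<^sub>2 \<longrightarrow> b \<le> h x)"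
      using no_UF_iff[of M h p q\<^sub>2, OF stp' up' q(2)] unfolding hM .
    ultimately show ?thesis unfolding free no_UFU[OF stp] by (simp only:)
  next
    case False
    then show ?thesis using no_UFU unfolding free by argo
  qed
  also have "\<dots> \<longleftrightarrow> height h"
  proof -
    have "y \<le> q\<^sub>1 \<longleftrightarrow> 2 * int y + c < int p" for y
      using two_le_p by (auto simp: q\<^sub>1_def)
    moreover have "k \<le> q\<^sub>2 \<longleftrightarrow> (2 - e) * int k < int p" for k
      using two_le_p by (auto simp: q\<^sub>2_def)
    ultimately show ?thesis unfolding height_def using assms by (simp only: simp_thms conj_assoc)
  qed
  finally show ?thesis .
qed

text \<open>The labels on or below the graph of \<open>g\<close> form a set \<open>X\<close> with
  finite positive part; the partition with these diagonal hooks has \<open>X\<close> as its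
  \<open>maya\<close> set.\<close>

lemma ex_core:
  assumes "profile g"
  shows "\<exists>xs\<in>cores. profile_of xs g"
proof -
  from assms have per: "g (j + int (s + d)) = g j - int d" and refl: "g (- c - j) = - g j"
    and down: "g j - 1 \<le> g (j + 1)" and up: "x \<le> y \<Longrightarrow> y < x + int p \<Longrightarrow> g y \<le> g x + 1" for j x y
    unfolding profile_def by blast+
  have per': "g (j + int (s + d) * t) = g j - int d * t" for j t
  proof (induction t rule: int_induct[where k = 0])
    case (step1 t)
    then show ?case using per[of "j + int (s + d) * t"] by (simp add: algebra_simps)
  next
    case (step2 t)
    then show ?case using per[of "j + int (s + d) * (t - 1)"] by (simp add: algebra_simps)
  qed simp
  define X where "X = {z. \<exists>i j. z = lab i j \<and> i \<le> g j}"
  have X: "lab i j \<in> X \<longleftrightarrow> i \<le> g j" for i j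
  proof
    assume "lab i j \<in> X"
    then obtain i' j' where "lab i j = lab i' j'" "i' \<le> g j'" by (auto simp: X_def)
    then show "i \<le> g j" using per' by (elim lab_eqD) auto
  qed (auto simp: X_def)
  have "finite {z \<in> X. 0 < z}"
  proof (rule finite_subset)
    \<comment> \<open>By \<open>lab_shift\<close> every label occurs in a column of one period,
      where the top row gives the bound.\<close>
    let ?B = "Max ((\<lambda>j. lab (g j) j) ` {0..<int (s + d)})"
    show "{z \<in> X. 0 < z} \<subseteq> {0..?B}"
    proof
      fix z assume z: "z \<in> {z \<in> X. 0 < z}"
      then obtain i j where ij: "z = lab i j" "i \<le> g j" by (auto simp: X_def)
      define r t where "r = j mod int (s + d)" and "t = j div int (s + d)"
      have j: "j = r + int (s + d) * t" by (simp add: r_def t_def)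
      have r: "r \<in> {0..<int (s + d)}" using s_pos by (simp add: r_def)
      have "z = lab (i + int d * t) r" unfolding ij(1) j by (rule lab_shift)
      also have "\<dots> \<le> lab (g r) r"
        using ij(2) per'[of r t] unfolding lab_def j[symmetric] by (simp add: mult_left_mono)
      also have "\<dots> \<le> ?B" using r by (intro Max_ge) auto
      finally show "z \<in> {0..?B}" using z by simp
    qed
  qed simp
  moreover have oddX: "odd z" if "z \<in> X" for z using that odd_lab by (auto simp: X_def)
  ultimately have "\<exists>xs. is_partition xs \<and> self_conjugate xs \<and> {z \<in> maya xs. 0 < z} = {z \<in> X. 0 < z}"
    by (intro exists_self_conjugate_maya) blast+
  then obtain xs where xs: "is_partition xs" "self_conjugate xs"
    and pos: "{z \<in> maya xs. 0 < z} = {z \<in> X. 0 < z}" by blast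
  have neg: "- z \<in> X \<longleftrightarrow> z \<notin> X" if z: "odd z" for z
  proof -
    obtain i j where "z = lab i j" using ex_lab[OF z] by blast
    then show ?thesis using refl[of j] by (auto simp: uminus_lab X)
  qed
  \<comment> \<open>Both sets contain exactly one of \<open>z\<close> and \<open>- z\<close> for odd
    \<open>z\<close>, so their positive parts determine them.\<close>
  have "z \<in> maya xs \<longleftrightarrow> z \<in> X" for z
  proof (cases "odd z")
    case True
    then have "z \<noteq> 0" by auto
    then consider "0 < z" | "0 < - z" by linarith
    then show ?thesis
      using pos neg[OF True] maya_uminus[OF xs True] by cases blast+
  qed (use oddX maya_odd in blast)
  then have mX: "maya xs = X" by blast
  then have prof: "profile_of xs g" by (simp add: profile_of_def X)
  have "z - 2 * int (s + k * d) \<in> maya xs" if k: "k \<le> p" and z: "z \<in> maya xs" for k z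
  proof -
    obtain i j where ij: "z = lab i j" "i \<le> g j" using z mX by (auto simp: X_def)
    \<comment> \<open>For \<open>k = 0\<close> this is the bound on drops, otherwise the bound on
      rises at distance \<open>k - 1\<close>.\<close>
    have "g j - 1 \<le> g (j - (int k - 1))"
    proof (cases k)
      case (Suc k')
      then show ?thesis using up[of "j - int k'" j] k by simp
    qed (use down in simp)
    then show ?thesis using ij(2) unfolding ij(1) lab_minus mX X by linarith
  qed
  then have "xs \<in> cores" unfolding cores_iff using xs by blast
  then show ?thesis using prof by blast
qed

end

section \<open>The bijection between cores and paths\<close>

theorem theorem1p7:
  fixes s d p :: nat
  assumes "0 < s" and "0 < d" and "coprime s d" and "2 \<le> p"
  shows "bij_betw (\<phi> s d)
    (SC (map (\<lambda>k. s + k * d) [0..<p + 1]))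
    {P \<in> free_motzkin (int (s div 2 + (d + 1) div 2)) (- int ((d + 1) div 2)).
       (3 \<le> p \<longrightarrow> (\<forall>i\<le>p - 3. \<not> sublist ([U] @ replicate i F @ [U]) P)) \<and>
       (odd s \<and> even d \<longrightarrow>
          (4 \<le> p \<longrightarrow> (\<forall>j\<le>(p - 4) div 2. \<not> prefix (replicate j F @ [U]) P)) \<and>
          (3 \<le> p \<longrightarrow> (\<forall>k\<le>(p - 3) div 2. \<not> suffix ([U] @ replicate k F) P))) \<and>
       (odd s \<and> odd d \<longrightarrow>
          (4 \<le> p \<longrightarrow> (\<forall>j\<le>(p - 4) div 2. \<not> prefix (replicate j F @ [U]) P)) \<and>
          (\<forall>k\<le>p - 2. \<not> suffix ([U] @ replicate k F) P)) \<and>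
       (even s \<and> odd d \<longrightarrow>
          (3 \<le> p \<longrightarrow> (\<forall>j\<le>(p - 3) div 2. \<not> prefix (replicate j F @ [U]) P)) \<and>
          (\<forall>k\<le>p - 2. \<not> suffix ([U] @ replicate k F) P))}"
    (is "bij_betw _ _ ?T")
proof -
  interpret abacus s d p by (rule abacus.intro) (fact assms)+
  let ?h = "\<lambda>g :: int \<Rightarrow> int. (\<lambda>j. g (int j))(M := b)"
  have part: "is_partition xs" "self_conjugate xs" if "xs \<in> cores" for xs
    using that by (auto simp: SC_def)
  have \<phi>: "\<phi> s d xs = path (?h g) M" if "xs \<in> cores" "profile g" "profile_of xs g" for xs g
    using \<phi>_eq_path[OF part[OF that(1)] that(2,3)] .
  have h0: "?h g 0 = 0" if "profile g" for g using height_profile[OF that] unfolding height_def by blast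
  show ?thesis
  proof (rule bij_betw_imageI)
    show "inj_on (\<phi> s d) cores"
    proof (rule inj_onI)
      fix xs ys assume xs: "xs \<in> cores" and ys: "ys \<in> cores" and eq: "\<phi> s d xs = \<phi> s d ys"
      obtain g where g: "profile g" "profile_of xs g" using ex_profile[OF xs] by blast
      obtain g' where g': "profile g'" "profile_of ys g'" using ex_profile[OF ys] by blast
      have "path (?h g) M = path (?h g') M" using eq \<phi>[OF xs g] \<phi>[OF ys g'] by simp
      then have eq': "?h g j = ?h g' j" if "j \<le> M" for j
        using path_eqD[OF _ _ that] h0[OF g(1)] h0[OF g'(1)] by (simp only:)
      have "g (int j) = g' (int j)" if "j < M" for j
        using eq'[of j] that by simp
      then have "g = g'" using g(1) g'(1) by (intro profile_eqI)
      then have "z \<in> maya xs \<longleftrightarrow> z \<in> maya ys" for z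
        using ex_lab[of z] maya_odd g(2) g'(2) by (metis profile_ofD)
      then have "maya xs = maya ys" by blast
      then show "xs = ys" using maya_inject part(1) xs ys by blast
    qed
    show "\<phi> s d ` cores = ?T"
    proof (intro equalityI subsetI)
      fix P assume "P \<in> \<phi> s d ` cores"
      then obtain xs where xs: "xs \<in> cores" "P = \<phi> s d xs" by blast
      obtain g where g: "profile g" "profile_of xs g" using ex_profile[OF xs(1)] by blast
      show "P \<in> ?T"
        unfolding xs(2) \<phi>[OF xs(1) g] admissible_path_iff[of "?h g", OF h0[OF g(1)]]
        by (rule height_profile[OF g(1)])
    next
      fix P assume P: "P \<in> ?T"
      from free_motzkin_eq_path[OF CollectD[OF this, THEN conjunct1]]
      obtain h where h: "h 0 = 0" "P = path h M" by blast
      have height: "height h" using P unfolding h(2) admissible_path_iff[of h, OF h(1)] .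
      note ext = profile_extend[OF height]
      obtain xs where xs: "xs \<in> cores" "profile_of xs (extend h)" using ex_core[OF ext(1)] by blast
      have "h M = b" using height unfolding height_def by blast
      \<comment> \<open>Below \<open>M\<close> the extension returns \<open>h\<close>, and at
        \<open>M\<close> the update supplies \<open>b = h M\<close>.\<close>
      then have "?h (extend h) j = h j" if "j \<le> M" for j
        using that ext(2)[of j] by (cases "j = M") (auto split: if_splits)
      then have "path (?h (extend h)) M = P" unfolding h(2) by (rule path_cong)
      then have "P = \<phi> s d xs" using \<phi>[OF xs(1) ext(1) xs(2)] by (simp only:)
      then show "P \<in> \<phi> s d ` cores" using xs(1) by blast
    qed
  qed
qed

end
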